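(* Let $(\mathcal{M},g)$ be a smooth Riemannian manifold with Levi-Civita connection $D$, with sectional curvature $K$, Ricci curvature $\mathrm{Ric}$ and scalar curvature $S$. Let $\varepsilon$ be a random function on $\mathcal{M}$ that is almost surely $C^2$, and put $\widetilde X=\varepsilon X$ for every smooth vector field $X$. Then, almost surely, the stochastic sectional curvature $\widetilde K$, stochastic Ricci curvature $\widetilde{\mathrm{Ric}}$ and stochastic scalar curvature $\widetilde S$ are given by: 1. $\widetilde K=K$; 2. $\widetilde{\mathrm{Ric}}=\varepsilon^3\,\mathrm{Ric}$; 3. $\widetilde S=\varepsilon^3 S$.
   Context: Write $\langle X,Y\rangle=g(X,Y)$ and $R(X,Y)Z=D_XD_YZ-D_YD_XZ-D_{[X,Y]}Z$ for the curvature tensor of $D$; set $R(X,Y,Z,W)=\langle R(Z,W)X,Y\rangle$. In local coordinates $R(\partial_i,\partial_j)\partial_k=R^l_{kij}\partial_l$ (summation convention). The classical curvatures are $$K(X,Y)=\frac{R(X,Y,X,Y)}{\langle X,X\rangle\langle Y,Y\rangle-\langle X,Y\rangle^2},\qquad \mathrm{Ric}_{ij}=R^k_{ikj},\qquad S=\mathrm{trace}_g\,\mathrm{Ric}.$$ The stochastic curvature tensor is $\widetilde R(X,Y)Z:=R(\widetilde X,\widetilde Y)\widetilde Z$, with coordinate components $\widetilde R(\partial_i,\partial_j)\partial_k=\widetilde R^l_{kij}\partial_l$. The stochastic curvatures are $$\widetilde K(X,Y)=\frac{R(\widetilde X,\widetilde Y,\widetilde X,\widetilde Y)}{\langle\widetilde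 X,\widetilde X\rangle\langle\widetilde Y,\widetilde Y\rangle-\langle\widetilde X,\widetilde Y\rangle^2},\qquad \widetilde{\mathrm{Ric}}_{ij}=\widetilde R^k_{ikj},\qquad \widetilde S=\mathrm{trace}_g\,\widetilde{\mathrm{Ric}}.$$ $K$ and $\widetilde K$ are considered wherever the corresponding denominators are nonzero (for $\widetilde K$: where $\varepsilon\neq0$ and $X,Y$ are linearly independent). *)

theory Defs
  imports "HOL-Probability.Probability"
begin

section \<open>Functions of class \<open>C\<^sup>k\<close> on open sets\<close>

fun Ck_on :: "nat \<Rightarrow> 'a::real_normed_vector set \<Rightarrow> ('a \<Rightarrow> 'b::real_normed_vector) \<Rightarrow> bool" where
  "Ck_on 0 S f \<longleftrightarrow> continuous_on S f"
| "Ck_on (Suc k) S f \<longleftrightarrow>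
     (\<forall>x\<in>S. f differentiable (at x)) \<and> (\<forall>v. Ck_on k S (\<lambda>x. frechet_derivative f (at x) v))"


section \<open>Smooth manifolds\<close>

text \<open>The manifold is a whole type \<open>'m\<close>; a chart is its domain together with the
  coordinate map into \<open>\<real>\<^sup>n\<close>.\<close>

type_synonym ('m, 'n) chart = "'m set \<times> ('m \<Rightarrow> real ^ 'n)"

definition param :: "('m, 'n) chart \<Rightarrow> real ^ 'n \<Rightarrow> 'm" where
  "param c = inv_into (fst c) (snd c)"

definition smooth_manifold ::
  "('m::{t2_space, second_countable_topology}, 'n::finite) chart set \<Rightarrow> bool" where
  "smooth_manifold A \<longleftrightarrow>
     (\<Union>c\<in>A. fst c) = UNIV \<and>
     (\<forall>c\<in>A. open (fst c) \<and> open (snd c ` fst c) \<and>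
             homeomorphism (fst c) (snd c ` fst c) (snd c) (param c)) \<and>
     (\<forall>c\<in>A. \<forall>d\<in>A. \<forall>k. Ck_on k (snd c ` (fst c \<inter> fst d)) (snd d \<circ> param c))"

definition Ck_fun :: "('m, 'n::finite) chart set \<Rightarrow> nat \<Rightarrow> 'm set \<Rightarrow> ('m \<Rightarrow> real) \<Rightarrow> bool" where
  "Ck_fun A k W f \<longleftrightarrow> (\<forall>c\<in>A. Ck_on k (snd c ` (W \<inter> fst c)) (f \<circ> param c))"


section \<open>Tangent vectors and vector fields\<close>

text \<open>A tangent vector at \<open>p\<close> is a directional derivative, i.e. a functional on real
  functions. It acts on all functions that are differentiable at \<open>p\<close>, not only on smooth
  ones, because a vector field has to be applied to functions of class \<open>C\<^sup>1\<close>; on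
  functions that are not differentiable at \<open>p\<close> its value is fixed to be \<open>0\<close>.\<close>

type_synonym 'm tvec = "('m \<Rightarrow> real) \<Rightarrow> real"
type_synonym 'm vfield = "'m \<Rightarrow> 'm tvec"

definition dir_deriv :: "('m, 'n::finite) chart \<Rightarrow> 'm \<Rightarrow> real ^ 'n \<Rightarrow> 'm tvec" where
  "dir_deriv c p a = (\<lambda>f.
     if (f \<circ> param c) differentiable (at (snd c p))
     then frechet_derivative (f \<circ> param c) (at (snd c p)) a else 0)"

definition tangent_space :: "('m, 'n::finite) chart set \<Rightarrow> 'm \<Rightarrow> 'm tvec set" where
  "tangent_space A p = {dir_deriv c p a | c a. c \<in> A \<and> p \<in> fst c}"

definition coord_field :: "('m, 'n::finite) chart \<Rightarrow> 'n \<Rightarrow> 'm vfield" where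
  "coord_field c i = (\<lambda>p. dir_deriv c p (axis i 1))"

text \<open>The \<open>i\<close>-th component of a tangent vector \<open>v\<close> with respect to the coordinate basis
  is \<open>v\<close> applied to the \<open>i\<close>-th coordinate function.\<close>

definition comp_in :: "('m, 'n::finite) chart \<Rightarrow> 'n \<Rightarrow> 'm tvec \<Rightarrow> real" where
  "comp_in c i v = v (\<lambda>q. snd c q $ i)"

text \<open>Vector fields on an open set \<open>W\<close> are total functions whose values outside \<open>W\<close> are
  irrelevant.\<close>

definition Ck_vfield :: "('m, 'n::finite) chart set \<Rightarrow> nat \<Rightarrow> 'm set \<Rightarrow> 'm vfield \<Rightarrow> bool" where
  "Ck_vfield A k W X \<longleftrightarrow>
     (\<forall>p\<in>W. X p \<in> tangent_space A p) \<and>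
     (\<forall>c\<in>A. \<forall>i. Ck_on k (snd c ` (W \<inter> fst c)) ((\<lambda>p. comp_in c i (X p)) \<circ> param c))"

definition smooth_vfield :: "('m, 'n::finite) chart set \<Rightarrow> 'm set \<Rightarrow> 'm vfield \<Rightarrow> bool" where
  "smooth_vfield A W X \<longleftrightarrow> (\<forall>k. Ck_vfield A k W X)"

definition vf_add :: "'m vfield \<Rightarrow> 'm vfield \<Rightarrow> 'm vfield" where
  "vf_add X Y = (\<lambda>p f. X p f + Y p f)"

definition vf_diff :: "'m vfield \<Rightarrow> 'm vfield \<Rightarrow> 'm vfield" where
  "vf_diff X Y = (\<lambda>p f. X p f - Y p f)"

definition vf_scale :: "('m \<Rightarrow> real) \<Rightarrow> 'm vfield \<Rightarrow> 'm vfield" where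
  "vf_scale h X = (\<lambda>p f. h p * X p f)"

definition vf_apply :: "'m vfield \<Rightarrow> ('m \<Rightarrow> real) \<Rightarrow> 'm \<Rightarrow> real" where
  "vf_apply X f = (\<lambda>p. X p f)"

definition lie_bracket ::
  "('m::topological_space, 'n::finite) chart set \<Rightarrow> 'm vfield \<Rightarrow> 'm vfield \<Rightarrow> 'm vfield" where
  "lie_bracket A X Y p =
     (THE w. w \<in> tangent_space A p \<and>
        (\<forall>V f. open V \<and> p \<in> V \<and> (\<forall>k. Ck_fun A k V f) \<longrightarrow>
           w f = X p (vf_apply Y f) - Y p (vf_apply X f)))"


section \<open>Riemannian metrics and the Levi-Civita connection\<close>

type_synonym 'm metric = "'m \<Rightarrow> 'm tvec \<Rightarrow> 'm tvec \<Rightarrow> real"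

definition riemannian_metric :: "('m, 'n::finite) chart set \<Rightarrow> 'm metric \<Rightarrow> bool" where
  "riemannian_metric A g \<longleftrightarrow>
     (\<forall>p. \<forall>u\<in>tangent_space A p. \<forall>v\<in>tangent_space A p.
        g p u v = g p v u \<and>
        (\<forall>w\<in>tangent_space A p. \<forall>a b.
           g p (\<lambda>f. a * u f + b * v f) w = a * g p u w + b * g p v w) \<and>
        (u \<noteq> (\<lambda>_. 0) \<longrightarrow> g p u u > 0)) \<and>
     (\<forall>c\<in>A. \<forall>i j k. Ck_on k (snd c ` fst c)
        ((\<lambda>p. g p (coord_field c i p) (coord_field c j p)) \<circ> param c))"

definition inner_vf :: "'m metric \<Rightarrow> 'm vfield \<Rightarrow> 'm vfield \<Rightarrow> 'm \<Rightarrow> real" where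
  "inner_vf g X Y = (\<lambda>p. g p (X p) (Y p))"

text \<open>\<open>D X Y\<close> stands for the covariant derivative of \<open>Y\<close> in direction \<open>X\<close>. Since the fields
  \<open>\<epsilon> X\<close> are only \<open>C\<^sup>2\<close>, and since coordinate fields are only defined locally, a connection
  is taken to act on vector fields of finite differentiability over arbitrary open
  sets, compatibly with restriction to smaller open sets.\<close>

type_synonym 'm conn = "'m vfield \<Rightarrow> 'm vfield \<Rightarrow> 'm vfield"

definition affine_connection ::
  "('m::topological_space, 'n::finite) chart set \<Rightarrow> 'm conn \<Rightarrow> bool" where
  "affine_connection A D \<longleftrightarrow> (\<forall>W. open W \<longrightarrow>
     (\<forall>k X Y. Ck_vfield A k W X \<and> Ck_vfield A (Suc k) W Y \<longrightarrow> Ck_vfield A k W (D X Y)) \<and>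
     (\<forall>X X' Y Y'. Ck_vfield A 0 W X \<and> Ck_vfield A 1 W Y \<and>
        (\<forall>p\<in>W. X' p = X p \<and> Y' p = Y p) \<longrightarrow> (\<forall>p\<in>W. D X' Y' p = D X Y p)) \<and>
     (\<forall>X X' Y. Ck_vfield A 0 W X \<and> Ck_vfield A 0 W X' \<and> Ck_vfield A 1 W Y \<longrightarrow>
        (\<forall>p\<in>W. D (vf_add X X') Y p = vf_add (D X Y) (D X' Y) p)) \<and>
     (\<forall>h X Y. Ck_fun A 0 W h \<and> Ck_vfield A 0 W X \<and> Ck_vfield A 1 W Y \<longrightarrow>
        (\<forall>p\<in>W. D (vf_scale h X) Y p = vf_scale h (D X Y) p)) \<and>
     (\<forall>X Y Y'. Ck_vfield A 0 W X \<and> Ck_vfield A 1 W Y \<and> Ck_vfield A 1 W Y' \<longrightarrow>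
        (\<forall>p\<in>W. D X (vf_add Y Y') p = vf_add (D X Y) (D X Y') p)) \<and>
     (\<forall>h X Y. Ck_fun A 1 W h \<and> Ck_vfield A 0 W X \<and> Ck_vfield A 1 W Y \<longrightarrow>
        (\<forall>p\<in>W. D X (vf_scale h Y) p =
           vf_add (vf_scale (vf_apply X h) Y) (vf_scale h (D X Y)) p)))"

definition torsion_free ::
  "('m::topological_space, 'n::finite) chart set \<Rightarrow> 'm conn \<Rightarrow> bool" where
  "torsion_free A D \<longleftrightarrow> (\<forall>W X Y. open W \<and> Ck_vfield A 1 W X \<and> Ck_vfield A 1 W Y \<longrightarrow>
     (\<forall>p\<in>W. vf_diff (D X Y) (D Y X) p = lie_bracket A X Y p))"

definition metric_compatible ::
  "('m::topological_space, 'n::finite) chart set \<Rightarrow> 'm metric \<Rightarrow> 'm conn \<Rightarrow> bool" where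
  "metric_compatible A g D \<longleftrightarrow>
     (\<forall>W X Y Z. open W \<and> Ck_vfield A 0 W X \<and> Ck_vfield A 1 W Y \<and> Ck_vfield A 1 W Z \<longrightarrow>
        (\<forall>p\<in>W. vf_apply X (inner_vf g Y Z) p
                 = inner_vf g (D X Y) Z p + inner_vf g Y (D X Z) p))"

definition levi_civita ::
  "('m::topological_space, 'n::finite) chart set \<Rightarrow> 'm metric \<Rightarrow> 'm conn \<Rightarrow> bool" where
  "levi_civita A g D \<longleftrightarrow>
     affine_connection A D \<and> torsion_free A D \<and> metric_compatible A g D"


section \<open>Classical curvatures\<close>

definition curvature ::
  "('m::topological_space, 'n::finite) chart set \<Rightarrow> 'm conn \<Rightarrow>
   'm vfield \<Rightarrow> 'm vfield \<Rightarrow> 'm vfield \<Rightarrow> 'm vfield" where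
  "curvature A D X Y Z =
     vf_diff (vf_diff (D X (D Y Z)) (D Y (D X Z))) (D (lie_bracket A X Y) Z)"

text \<open>Note the order of the arguments: \<open>R(X,Y,Z,W) = \<langle>R(Z,W)X, Y\<rangle>\<close>.\<close>

definition curvature4 ::
  "('m::topological_space, 'n::finite) chart set \<Rightarrow> 'm metric \<Rightarrow> 'm conn \<Rightarrow>
   'm vfield \<Rightarrow> 'm vfield \<Rightarrow> 'm vfield \<Rightarrow> 'm vfield \<Rightarrow> 'm \<Rightarrow> real" where
  "curvature4 A g D X Y Z W = inner_vf g (curvature A D Z W X) Y"

definition sectional ::
  "('m::topological_space, 'n::finite) chart set \<Rightarrow> 'm metric \<Rightarrow> 'm conn \<Rightarrow>
   'm vfield \<Rightarrow> 'm vfield \<Rightarrow> 'm \<Rightarrow> real" where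
  "sectional A g D X Y p =
     curvature4 A g D X Y X Y p /
     (inner_vf g X X p * inner_vf g Y Y p - (inner_vf g X Y p)\<^sup>2)"

text \<open>\<open>curv_comp A D c l k i j p\<close> is \<open>R\<^sup>l\<^sub>k\<^sub>i\<^sub>j\<close> at \<open>p\<close>, the \<open>l\<close>-th component of
  \<open>R(\<partial>\<^sub>i,\<partial>\<^sub>j)\<partial>\<^sub>k\<close>.\<close>

definition curv_comp ::
  "('m::topological_space, 'n::finite) chart set \<Rightarrow> 'm conn \<Rightarrow> ('m, 'n) chart \<Rightarrow>
   'n \<Rightarrow> 'n \<Rightarrow> 'n \<Rightarrow> 'n \<Rightarrow> 'm \<Rightarrow> real" where
  "curv_comp A D c l k i j p =
     comp_in c l (curvature A D (coord_field c i) (coord_field c j) (coord_field c k) p)"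

definition ricci ::
  "('m::topological_space, 'n::finite) chart set \<Rightarrow> 'm conn \<Rightarrow> ('m, 'n) chart \<Rightarrow>
   'n \<Rightarrow> 'n \<Rightarrow> 'm \<Rightarrow> real" where
  "ricci A D c i j p = (\<Sum>k\<in>UNIV. curv_comp A D c k i k j p)"

text \<open>\<open>g\<^sup>i\<^sup>j T\<^sub>i\<^sub>j\<close> at \<open>p\<close> for the components \<open>T\<^sub>i\<^sub>j\<close> of a bilinear form in the chart \<open>c\<close>.\<close>

definition gram :: "'m metric \<Rightarrow> ('m, 'n::finite) chart \<Rightarrow> 'm \<Rightarrow> real ^ 'n ^ 'n" where
  "gram g c p = (\<chi> i j. g p (coord_field c i p) (coord_field c j p))"

definition metric_trace ::
  "'m metric \<Rightarrow> ('m, 'n::finite) chart \<Rightarrow> 'm \<Rightarrow> ('n \<Rightarrow> 'n \<Rightarrow> real) \<Rightarrow> real" where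
  "metric_trace g c p T = (\<Sum>i\<in>UNIV. \<Sum>j\<in>UNIV. matrix_inv (gram g c p) $ i $ j * T i j)"

definition scalar_curv ::
  "('m::topological_space, 'n::finite) chart set \<Rightarrow> 'm metric \<Rightarrow> 'm conn \<Rightarrow>
   ('m, 'n) chart \<Rightarrow> 'm \<Rightarrow> real" where
  "scalar_curv A g D c p = metric_trace g c p (\<lambda>i j. ricci A D c i j p)"


section \<open>Stochastic curvatures\<close>

text \<open>These are the curvatures for one realisation \<open>e\<close> of the random function.\<close>

definition stoch_curvature ::
  "('m::topological_space, 'n::finite) chart set \<Rightarrow> 'm conn \<Rightarrow> ('m \<Rightarrow> real) \<Rightarrow>
   'm vfield \<Rightarrow> 'm vfield \<Rightarrow> 'm vfield \<Rightarrow> 'm vfield" where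
  "stoch_curvature A D e X Y Z = curvature A D (vf_scale e X) (vf_scale e Y) (vf_scale e Z)"

definition stoch_sectional ::
  "('m::topological_space, 'n::finite) chart set \<Rightarrow> 'm metric \<Rightarrow> 'm conn \<Rightarrow> ('m \<Rightarrow> real) \<Rightarrow>
   'm vfield \<Rightarrow> 'm vfield \<Rightarrow> 'm \<Rightarrow> real" where
  "stoch_sectional A g D e X Y p =
     (let X' = vf_scale e X; Y' = vf_scale e Y in
        curvature4 A g D X' Y' X' Y' p /
        (inner_vf g X' X' p * inner_vf g Y' Y' p - (inner_vf g X' Y' p)\<^sup>2))"

definition stoch_curv_comp ::
  "('m::topological_space, 'n::finite) chart set \<Rightarrow> 'm conn \<Rightarrow> ('m \<Rightarrow> real) \<Rightarrow>
   ('m, 'n) chart \<Rightarrow> 'n \<Rightarrow> 'n \<Rightarrow> 'n \<Rightarrow> 'n \<Rightarrow> 'm \<Rightarrow> real" where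
  "stoch_curv_comp A D e c l k i j p =
     comp_in c l (stoch_curvature A D e (coord_field c i) (coord_field c j) (coord_field c k) p)"

definition stoch_ricci ::
  "('m::topological_space, 'n::finite) chart set \<Rightarrow> 'm conn \<Rightarrow> ('m \<Rightarrow> real) \<Rightarrow>
   ('m, 'n) chart \<Rightarrow> 'n \<Rightarrow> 'n \<Rightarrow> 'm \<Rightarrow> real" where
  "stoch_ricci A D e c i j p = (\<Sum>k\<in>UNIV. stoch_curv_comp A D e c k i k j p)"

definition stoch_scalar_curv ::
  "('m::topological_space, 'n::finite) chart set \<Rightarrow> 'm metric \<Rightarrow> 'm conn \<Rightarrow> ('m \<Rightarrow> real) \<Rightarrow>
   ('m, 'n) chart \<Rightarrow> 'm \<Rightarrow> real" where
  "stoch_scalar_curv A g D e c p = metric_trace g c p (\<lambda>i j. stoch_ricci A D e c i j p)"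

definition lin_indep2 :: "'m tvec \<Rightarrow> 'm tvec \<Rightarrow> bool" where
  "lin_indep2 u v \<longleftrightarrow> (\<forall>a b. (\<lambda>f. a * u f + b * v f) = (\<lambda>_. 0) \<longrightarrow> a = 0 \<and> b = 0)"

end

theory Submission
  imports Defs
begin

text \<open>The stochastic curvatures are the classical ones evaluated on the fields \<open>eX\<close>, where \<open>e\<close> is one
  realisation of the random function. As \<open>e\<close> is of class \<open>C\<^sup>2\<close> almost surely, the theorem is a statement
  about a single function \<open>e\<close>, and it says that the curvature tensor is tensorial:
  \<open>R(eX,eY)(eZ) = e\<^sup>3 R(X,Y)Z\<close> (lemma \<open>curvature_scaled\<close>). Ricci and scalar curvature are linear in the
  components of this tensor, so they inherit the factor \<open>e\<^sup>3\<close>. In the sectional curvature the numerator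
  pairs the tensor with one more rescaled field, and the resulting \<open>e\<^sup>4\<close> cancels against the
  denominator.

  For smooth \<open>e\<close> the tensoriality of \<open>R\<close> is classical; here every step has to respect that \<open>e\<close> can be
  differentiated only twice. Expanding with the Leibniz rule gives
  \<open>D\<^bsub>eX\<^esub> D\<^bsub>eY\<^esub>(eZ) - D\<^bsub>eY\<^esub> D\<^bsub>eX\<^esub>(eZ) = e\<^sup>3 (D\<^bsub>X\<^esub> D\<^bsub>Y\<^esub> Z - D\<^bsub>Y\<^esub> D\<^bsub>X\<^esub> Z) + e\<^sup>2 (X(e) D\<^bsub>Y\<^esub> Z - Y(e) D\<^bsub>X\<^esub> Z) + e\<^sup>2 (X(Y e) - Y(X e)) Z\<close>,
  while \<open>[eX,eY] = e\<^sup>2 [X,Y] + e X(e) Y - e Y(e) X\<close> (lemma \<open>lie_bracket_scaled\<close>, from vanishing torsion)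
  gives
  \<open>D\<^bsub>[eX,eY]\<^esub>(eZ) = e\<^sup>3 D\<^bsub>[X,Y]\<^esub> Z + e\<^sup>2 (X(e) D\<^bsub>Y\<^esub> Z - Y(e) D\<^bsub>X\<^esub> Z) + e\<^sup>2 [X,Y](e) Z\<close>.
  The terms with first derivatives of \<open>e\<close> cancel, and those with second derivatives cancel because
  \<open>[X,Y](e) = X(Y e) - Y(X e)\<close>.

  This last identity carries the analytic content (lemma \<open>lie_bracket_eq_commutator\<close>). The Lie bracket
  is characterised by its action on smooth functions only, and \<open>e\<close> is not smooth. In a chart, the symmetry
  of second derivatives (lemma \<open>symmetric_second_derivative\<close>) shows that the commutator acts on every
  function of class \<open>C\<^sup>2\<close> as one tangent vector. Since a tangent vector is determined by its values on
  the smooth coordinate functions, that vector is the bracket.\<close>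

section \<open>Calculus of functions of class \<open>C\<^sup>k\<close>\<close>

lemma Ck_on_subset: "Ck_on k T f \<Longrightarrow> S \<subseteq> T \<Longrightarrow> Ck_on k S f"
  by (induction k arbitrary: f) (auto intro: continuous_on_subset)

lemma Ck_on_cong:
  assumes "open S" "\<And>x. x \<in> S \<Longrightarrow> f x = g x" "Ck_on k S f"
  shows "Ck_on k S g"
  using assms(2,3)
proof (induction k arbitrary: f g)
  case 0
  then show ?case by (auto cong: continuous_on_cong)
next
  case (Suc k)
  have g: "g differentiable (at x) \<and> frechet_derivative f (at x) = frechet_derivative g (at x)"
    if "x \<in> S" for x
  proof -
    have f: "f differentiable (at x)" using Suc.prems that by simp
    then have "(f has_derivative frechet_derivative f (at x)) (at x)"
      by (simp add: frechet_derivative_works)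
    then have "(g has_derivative frechet_derivative f (at x)) (at x)"
      by (rule has_derivative_transform_within_open[OF _ assms(1) that]) (use Suc.prems in auto)
    then show ?thesis
      using frechet_derivative_at differentiable_def by blast
  qed
  have "Ck_on k S (\<lambda>x. frechet_derivative g (at x) v)" for v
    by (rule Suc.IH[of "\<lambda>x. frechet_derivative f (at x) v"]) (use Suc.prems g in auto)
  with g show ?case by simp
qed

lemma Ck_on_Suc_D:
  "Ck_on (Suc k) S f \<Longrightarrow> Ck_on k S f"
proof (induction k arbitrary: f)
  case 0
  then show ?case
    by (auto intro!: continuous_at_imp_continuous_on differentiable_imp_continuous_within)
next
  case (Suc k)
  then show ?case by (metis Ck_on.simps(2))
qed

lemma Ck_on_mono: "Ck_on k S f \<Longrightarrow> j \<le> k \<Longrightarrow> Ck_on j S f"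
  by (induction k) (auto simp del: Ck_on.simps simp: le_Suc_eq dest: Ck_on_Suc_D)

lemma Ck_on_const: "Ck_on k S (\<lambda>x. a)"
  by (induction k arbitrary: a) auto

text \<open>The recursion for \<open>C\<^sup>k\<close> speaks of \<^const>\<open>frechet_derivative\<close>, a choice of a derivative. All
  closure properties go through this rule, which accepts any explicit formula for the derivative.\<close>

lemma Ck_on_SucI:
  assumes "open S" "\<And>x. x \<in> S \<Longrightarrow> (f has_derivative f' x) (at x)"
    "\<And>v. Ck_on k S (\<lambda>x. f' x v)"
  shows "Ck_on (Suc k) S f"
proof -
  have "frechet_derivative f (at x) = f' x" if "x \<in> S" for x
    using assms(2)[OF that] frechet_derivative_at by metis
  then have "Ck_on k S (\<lambda>x. frechet_derivative f (at x) v)" for v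
    using Ck_on_cong[OF assms(1) _ assms(3)[of v], of "\<lambda>x. frechet_derivative f (at x) v"] by simp
  with assms(2) show ?thesis by (auto simp: differentiable_def)
qed

lemma Ck_on_Suc_has_derivative:
  "Ck_on (Suc k) S f \<Longrightarrow> x \<in> S \<Longrightarrow> (f has_derivative frechet_derivative f (at x)) (at x)"
  by (simp add: frechet_derivative_works)

lemma Ck_on_add:
  assumes "open S" "Ck_on k S f" "Ck_on k S g"
  shows "Ck_on k S (\<lambda>x. f x + g x)"
  using assms(2,3)
proof (induction k arbitrary: f g)
  case 0
  then show ?case by (auto intro: continuous_intros)
next
  case (Suc k)
  show ?case
    by (rule Ck_on_SucI[OF assms(1) has_derivative_add[OF
          Ck_on_Suc_has_derivative[OF Suc.prems(1)] Ck_on_Suc_has_derivative[OF Suc.prems(2)]]])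
       (use Suc in auto)
qed

lemma Ck_on_sum:
  assumes "open S" "\<And>i. i \<in> I \<Longrightarrow> Ck_on k S (f i)"
  shows "Ck_on k S (\<lambda>x. \<Sum>i\<in>I. f i x)"
  using assms(2)
  by (induction I rule: infinite_finite_induct) (auto intro: Ck_on_add[OF assms(1)] Ck_on_const)

lemma Ck_on_bounded_linear:
  assumes "open S" "bounded_linear L" "Ck_on k S f"
  shows "Ck_on k S (\<lambda>x. L (f x))"
  using assms(3)
proof (induction k arbitrary: f)
  case 0
  then show ?case using assms(2) by (auto intro: bounded_linear.continuous_on)
next
  case (Suc k)
  show ?case
    by (rule Ck_on_SucI[OF assms(1) bounded_linear.has_derivative[OF assms(2)
          Ck_on_Suc_has_derivative[OF Suc.prems]]]) (use Suc in auto)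
qed

lemma Ck_on_mult:
  fixes f g :: "'a::real_normed_vector \<Rightarrow> real"
  assumes "open S" "Ck_on k S f" "Ck_on k S g"
  shows "Ck_on k S (\<lambda>x. f x * g x)"
  using assms(2,3)
proof (induction k arbitrary: f g)
  case 0
  then show ?case by (auto intro: continuous_intros)
next
  case (Suc k)
  have "Ck_on k S f" "Ck_on k S g" using Suc.prems Ck_on_Suc_D by auto
  with Suc show ?case
    by (intro Ck_on_SucI[OF assms(1) has_derivative_mult[OF
          Ck_on_Suc_has_derivative[OF Suc.prems(1)] Ck_on_Suc_has_derivative[OF Suc.prems(2)]]]
        Ck_on_add[OF assms(1)]) auto
qed

lemma linear_axis_expansion:
  fixes L :: "real ^ 'n \<Rightarrow> real"
  assumes "linear L"
  shows "L a = (\<Sum>i\<in>UNIV. a $ i * L (axis i 1))"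
proof -
  have "L a = L (\<Sum>i\<in>UNIV. a $ i *\<^sub>R axis i 1)"
    by (simp add: basis_expansion flip: scalar_mult_eq_scaleR)
  also have "\<dots> = (\<Sum>i\<in>UNIV. a $ i * L (axis i 1))"
    by (simp add: linear_sum[OF assms] linear_cmul[OF assms])
  finally show ?thesis .
qed

text \<open>By the chain rule, \<open>D(f \<circ> g)(x) v = (\<Sum>\<^sub>i \<partial>\<^sub>i f(g x) \<cdot> (D g(x) v)\<^sub>i)\<close>. Expanding the outer
  derivative along the axes lets the induction hypothesis apply to the functions \<open>(\<partial>\<^sub>i f) \<circ> g\<close>; it
  does not apply to \<open>D f(g x)\<close> evaluated at a direction that itself depends on \<open>x\<close>.\<close>

lemma Ck_on_compose:
  fixes f :: "real ^ 'n \<Rightarrow> real"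
  assumes "open S" "g ` S \<subseteq> T" "Ck_on k T f" "Ck_on k S g"
  shows "Ck_on k S (\<lambda>x. f (g x))"
  using assms(3,4)
proof (induction k arbitrary: f)
  case 0
  then show ?case using assms(2) by (auto intro: continuous_on_compose2)
next
  case (Suc k)
  let ?f' = "\<lambda>x. frechet_derivative f (at (g x))" and ?g' = "\<lambda>x. frechet_derivative g (at x)"
  have gT: "g x \<in> T" if "x \<in> S" for x using that assms(2) by auto
  have der: "((\<lambda>x. f (g x)) has_derivative (\<lambda>v. ?f' x (?g' x v))) (at x)" if "x \<in> S" for x
    by (rule has_derivative_compose[OF Ck_on_Suc_has_derivative[OF Suc.prems(2) that]
          Ck_on_Suc_has_derivative[OF Suc.prems(1) gT[OF that]]])
  have "Ck_on k S (\<lambda>x. ?f' x (?g' x v))" for v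
  proof (rule Ck_on_cong[OF assms(1), where f = "\<lambda>x. \<Sum>i\<in>UNIV. ?g' x v $ i * ?f' x (axis i 1)"])
    fix x assume "x \<in> S"
    then have "linear (?f' x)"
      using Suc.prems(1) gT by (auto intro!: linear_frechet_derivative)
    then show "(\<Sum>i\<in>UNIV. ?g' x v $ i * ?f' x (axis i 1)) = ?f' x (?g' x v)"
      by (metis linear_axis_expansion)
  next
    have "Ck_on k S (\<lambda>x. ?f' x (axis i 1))" for i
      using Suc.IH[of "\<lambda>y. frechet_derivative f (at y) (axis i 1)"] Suc.prems Ck_on_Suc_D by auto
    moreover have "Ck_on k S (\<lambda>x. ?g' x v $ i)" for i
      using Suc.prems(2) by (auto intro!: Ck_on_bounded_linear[OF assms(1) bounded_linear_vec_nth])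
    ultimately show "Ck_on k S (\<lambda>x. \<Sum>i\<in>UNIV. ?g' x v $ i * ?f' x (axis i 1))"
      by (intro Ck_on_sum[OF assms(1)] Ck_on_mult[OF assms(1)])
  qed
  then show ?case by (intro Ck_on_SucI[OF assms(1) der])
qed

section \<open>Symmetry of second derivatives\<close>

text \<open>The mean value theorem, applied once along \<open>v\<close> and once along \<open>w\<close>, turns the second difference
  over a parallelogram into a mixed second derivative at an interior point. The second difference is
  symmetric in \<open>v\<close> and \<open>w\<close>, the right-hand side is not visibly so: this is what makes
  the order of differentiation irrelevant in the limit.\<close>

lemma second_difference_mean_value:
  fixes F :: "'a::real_normed_vector \<Rightarrow> real"
  assumes F: "Ck_on (Suc (Suc 0)) S F" and "t > 0"
    and in_S: "\<And>s u. 0 \<le> s \<Longrightarrow> s \<le> t \<Longrightarrow> 0 \<le> u \<Longrightarrow> u \<le> t \<Longrightarrow> x + s *\<^sub>R v + u *\<^sub>R w \<in> S"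
  obtains s u where "0 < s" "s < t" "0 < u" "u < t"
    "F (x + t *\<^sub>R v + t *\<^sub>R w) - F (x + t *\<^sub>R v) - (F (x + t *\<^sub>R w) - F x)
      = t\<^sup>2 * frechet_derivative (\<lambda>y. frechet_derivative F (at y) v) (at (x + s *\<^sub>R v + u *\<^sub>R w)) w"
proof -
  let ?d = "\<lambda>F y. frechet_derivative F (at y)"
  let ?G = "\<lambda>y. ?d F y v"
  have along: "((\<lambda>r. H (p + r *\<^sub>R z)) has_real_derivative ?d H (p + r *\<^sub>R z) z) (at r)"
    if "Ck_on (Suc k) S H" "p + r *\<^sub>R z \<in> S" for H :: "'a \<Rightarrow> real" and k p z r
  proof -
    have H: "(H has_derivative ?d H (p + r *\<^sub>R z)) (at (p + r *\<^sub>R z))"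
      by (rule Ck_on_Suc_has_derivative[OF that])
    have "((\<lambda>r. p + r *\<^sub>R z) has_derivative (\<lambda>h. h *\<^sub>R z)) (at r)"
      by (auto intro!: derivative_eq_intros)
    from has_derivative_compose[OF this H]
    have "((\<lambda>r. H (p + r *\<^sub>R z)) has_derivative (\<lambda>h. ?d H (p + r *\<^sub>R z) (h *\<^sub>R z))) (at r)" .
    moreover have "linear (?d H (p + r *\<^sub>R z))"
      using H has_derivative_linear by blast
    ultimately show ?thesis
      by (simp add: has_field_derivative_def linear_cmul mult.commute[of _ "?d H (p + r *\<^sub>R z) z"])
  qed
  have G: "Ck_on (Suc 0) S ?G" using F by simp
  let ?\<phi> = "\<lambda>s. F ((x + t *\<^sub>R w) + s *\<^sub>R v) - F (x + s *\<^sub>R v)"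
  have "\<exists>s. 0 < s \<and> s < t \<and> ?\<phi> t - ?\<phi> 0
      = (t - 0) * (?d F ((x + t *\<^sub>R w) + s *\<^sub>R v) v - ?d F (x + s *\<^sub>R v) v)"
  proof (rule MVT2[OF \<open>t > 0\<close>])
    fix s assume s: "0 \<le> s" "s \<le> t"
    show "(?\<phi> has_real_derivative ?d F ((x + t *\<^sub>R w) + s *\<^sub>R v) v - ?d F (x + s *\<^sub>R v) v) (at s)"
      using in_S[OF s, of t] in_S[OF s, of 0] \<open>t > 0\<close>
      by (intro DERIV_diff along[OF F]) (auto simp: algebra_simps)
  qed
  then obtain s where s: "0 < s" "s < t" and eq1: "?\<phi> t - ?\<phi> 0
      = t * (?d F ((x + t *\<^sub>R w) + s *\<^sub>R v) v - ?d F (x + s *\<^sub>R v) v)" by auto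
  let ?\<psi> = "\<lambda>u. ?G ((x + s *\<^sub>R v) + u *\<^sub>R w)"
  have "\<exists>u. 0 < u \<and> u < t \<and> ?\<psi> t - ?\<psi> 0 = (t - 0) * ?d ?G ((x + s *\<^sub>R v) + u *\<^sub>R w) w"
  proof (rule MVT2[OF \<open>t > 0\<close>])
    fix u assume u: "0 \<le> u" "u \<le> t"
    show "(?\<psi> has_real_derivative ?d ?G ((x + s *\<^sub>R v) + u *\<^sub>R w) w) (at u)"
      using in_S[OF _ _ u, of s] s by (intro along[OF G]) auto
  qed
  then obtain u where u: "0 < u" "u < t"
    and eq2: "?\<psi> t - ?\<psi> 0 = t * ?d ?G ((x + s *\<^sub>R v) + u *\<^sub>R w) w" by auto
  have "F (x + t *\<^sub>R v + t *\<^sub>R w) - F (x + t *\<^sub>R v) - (F (x + t *\<^sub>R w) - F x) = ?\<phi> t - ?\<phi> 0"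
    by (simp add: algebra_simps)
  also have "\<dots> = t * (?\<psi> t - ?\<psi> 0)"
    using eq1 by (simp add: algebra_simps)
  also have "\<dots> = t\<^sup>2 * ?d ?G ((x + s *\<^sub>R v) + u *\<^sub>R w) w"
    using eq2 by (simp add: power2_eq_square)
  finally show ?thesis using that s u by blast
qed

text \<open>Suppose that the two mixed derivatives at \<open>x\<close> differ by \<open>2e > 0\<close>. On a parallelogram with a corner
  at \<open>x\<close>, small enough for both mixed derivatives to stay within \<open>e\<close> of their values at \<open>x\<close>, the second
  difference equals \<open>t\<^sup>2\<close> times a value of either of them, which is a contradiction.\<close>

lemma symmetric_second_derivative:
  fixes F :: "'a::real_normed_vector \<Rightarrow> real"
  assumes "open S" "Ck_on (Suc (Suc 0)) S F" "x \<in> S"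
  shows "frechet_derivative (\<lambda>y. frechet_derivative F (at y) v) (at x) w
       = frechet_derivative (\<lambda>y. frechet_derivative F (at y) w) (at x) v"
proof (rule ccontr)
  define H where "H v w y = frechet_derivative (\<lambda>y. frechet_derivative F (at y) v) (at y) w" for v w y
  assume "\<not> ?thesis"
  then have ne: "H v w x - H w v x \<noteq> 0" by (simp add: H_def)
  have "continuous_on S (H v w)" for v w
    using assms(2) unfolding H_def by auto
  then have cont: "isCont (H v w) x" for v w
    using assms continuous_on_eq_continuous_at by blast
  define e where "e = \<bar>H v w x - H w v x\<bar> / 2"
  have e: "e > 0" using ne by (simp add: e_def)
  obtain d1 where d1: "d1 > 0" "\<And>y. dist y x < d1 \<Longrightarrow> \<bar>H v w y - H v w x\<bar> < e"
    using cont[of v w] e unfolding continuous_at_eps_delta dist_real_def by blast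
  obtain d2 where d2: "d2 > 0" "\<And>y. dist y x < d2 \<Longrightarrow> \<bar>H w v y - H w v x\<bar> < e"
    using cont[of w v] e unfolding continuous_at_eps_delta dist_real_def by blast
  obtain d3 where d3: "d3 > 0" "ball x d3 \<subseteq> S"
    using assms openE by metis
  define d where "d = min d1 (min d2 d3)"
  \<comment> \<open>The summand 1 keeps the quotient meaningful when \<open>v = w = 0\<close> and makes the bound below strict.\<close>
  define t where "t = d / (norm v + norm w + 1)"
  have d: "d > 0" using d1 d2 d3 by (simp add: d_def)
  have den: "norm v + norm w + 1 > 0" by (simp add: add_nonneg_pos)
  have t: "t > 0" "t * (norm v + norm w) < d"
    using d den by (auto simp: t_def field_simps)
  have near: "dist (x + s *\<^sub>R v + u *\<^sub>R w) x < d"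
    if "0 \<le> s" "s \<le> t" "0 \<le> u" "u \<le> t" for s u
  proof -
    have "dist (x + s *\<^sub>R v + u *\<^sub>R w) x = norm (s *\<^sub>R v + u *\<^sub>R w)"
      by (simp add: dist_norm)
    also have "\<dots> \<le> s * norm v + u * norm w"
      using that norm_triangle_ineq[of "s *\<^sub>R v" "u *\<^sub>R w"] by simp
    also have "\<dots> \<le> t * norm v + t * norm w"
      using that by (intro add_mono mult_right_mono) auto
    also have "\<dots> < d" using t by (simp add: algebra_simps)
    finally show ?thesis .
  qed
  have in_S: "x + s *\<^sub>R v + u *\<^sub>R w \<in> S"
    if "0 \<le> s" "s \<le> t" "0 \<le> u" "u \<le> t" for s u
    using near[OF that] d3 by (auto simp: d_def dist_commute mem_ball)
  obtain s u where su: "0 < s" "s < t" "0 < u" "u < t" and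
    1: "F (x + t *\<^sub>R v + t *\<^sub>R w) - F (x + t *\<^sub>R v) - (F (x + t *\<^sub>R w) - F x)
      = t\<^sup>2 * H v w (x + s *\<^sub>R v + u *\<^sub>R w)"
    using second_difference_mean_value[OF assms(2) t(1), of x v w] in_S unfolding H_def by metis
  have in_S': "x + s *\<^sub>R w + u *\<^sub>R v \<in> S"
    if "0 \<le> s" "s \<le> t" "0 \<le> u" "u \<le> t" for s u
    using in_S[OF that(3,4,1,2)] by (simp add: algebra_simps)
  obtain s' u' where su': "0 < s'" "s' < t" "0 < u'" "u' < t" and
    2: "F (x + t *\<^sub>R w + t *\<^sub>R v) - F (x + t *\<^sub>R w) - (F (x + t *\<^sub>R v) - F x)
      = t\<^sup>2 * H w v (x + s' *\<^sub>R w + u' *\<^sub>R v)"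
    using second_difference_mean_value[OF assms(2) t(1), of x w v] in_S' unfolding H_def by metis
  have "t\<^sup>2 * H v w (x + s *\<^sub>R v + u *\<^sub>R w) = t\<^sup>2 * H w v (x + s' *\<^sub>R w + u' *\<^sub>R v)"
    unfolding 1[symmetric] 2[symmetric] by (simp add: algebra_simps)
  then have "H v w (x + s *\<^sub>R v + u *\<^sub>R w) = H w v (x + s' *\<^sub>R w + u' *\<^sub>R v)"
    using t by simp
  moreover have "\<bar>H v w (x + s *\<^sub>R v + u *\<^sub>R w) - H v w x\<bar> < e"
    using near[of s u] su by (intro d1) (auto simp: d_def)
  moreover have "\<bar>H w v (x + s' *\<^sub>R w + u' *\<^sub>R v) - H w v x\<bar> < e"
    using near[of u' s'] su' by (intro d2) (auto simp: d_def algebra_simps)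
  ultimately have "\<bar>H v w x - H w v x\<bar> < 2 * e" by linarith
  then show False by (simp add: e_def)
qed

section \<open>Charts and tangent vectors\<close>

locale smooth_atlas =
  fixes A :: "('m::{t2_space, second_countable_topology}, 'n::finite) chart set"
  assumes smooth_manifold: "smooth_manifold A"
begin

lemma chart_exists: obtains c where "c \<in> A" "p \<in> fst c"
  using smooth_manifold unfolding smooth_manifold_def by (metis UNIV_I UN_E)

lemma open_domain: "c \<in> A \<Longrightarrow> open (fst c)"
  using smooth_manifold unfolding smooth_manifold_def by blast

lemma param_chart: "c \<in> A \<Longrightarrow> p \<in> fst c \<Longrightarrow> param c (snd c p) = p"
  using smooth_manifold unfolding smooth_manifold_def homeomorphism_def by blast

lemma chart_param: "c \<in> A \<Longrightarrow> W \<subseteq> fst c \<Longrightarrow> x \<in> snd c ` W \<Longrightarrow>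
    param c x \<in> W \<and> snd c (param c x) = x"
  using param_chart by fastforce

lemma open_chart_image:
  assumes "c \<in> A" "open W"
  shows "open (snd c ` (W \<inter> fst c))"
proof -
  have "homeomorphism (fst c) (snd c ` fst c) (snd c) (param c)" "open (snd c ` fst c)"
    using smooth_manifold assms(1) unfolding smooth_manifold_def by blast+
  moreover have "openin (top_of_set (fst c)) (W \<inter> fst c)"
    using assms by (metis inf_commute openin_open_Int)
  ultimately show ?thesis
    by (metis homeomorphism_imp_open_map openin_open_eq)
qed

lemma transition_smooth:
  "c \<in> A \<Longrightarrow> d \<in> A \<Longrightarrow> Ck_on k (snd c ` (fst c \<inter> fst d)) (snd d \<circ> param c)"
  using smooth_manifold unfolding smooth_manifold_def by blast

text \<open>Coordinate functions are smooth on their chart domain, so they may be used as test functions: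
  it is through them that a tangent vector is recovered from its action.\<close>

lemma coordinate_smooth:
  assumes "c \<in> A" shows "Ck_fun A k (fst c) (\<lambda>q. snd c q $ i)"
  unfolding Ck_fun_def
proof
  fix d assume d: "d \<in> A"
  show "Ck_on k (snd d ` (fst c \<inter> fst d)) ((\<lambda>q. snd c q $ i) \<circ> param d)"
    using Ck_on_bounded_linear[OF open_chart_image[OF d open_domain[OF assms]]
        bounded_linear_vec_nth, OF transition_smooth[OF d assms, of k, unfolded Int_commute[of "fst d"]]]
    by (simp add: o_def)
qed

lemma Ck_funD: "Ck_fun A k W f \<Longrightarrow> c \<in> A \<Longrightarrow> Ck_on k (snd c ` (W \<inter> fst c)) (f \<circ> param c)"
  by (simp add: Ck_fun_def)

lemma Ck_fun_differentiable:
  assumes "Ck_fun A (Suc k) W f" "c \<in> A" "p \<in> W" "p \<in> fst c"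
  shows "(f \<circ> param c) differentiable (at (snd c p))"
  using Ck_funD[OF assms(1,2)] assms(3,4) by auto

lemma Ck_fun_subset: "Ck_fun A k W f \<Longrightarrow> V \<subseteq> W \<Longrightarrow> Ck_fun A k V f"
  unfolding Ck_fun_def by (meson Ck_on_subset Int_mono image_mono subset_refl)

lemma Ck_fun_mono: "Ck_fun A k W f \<Longrightarrow> j \<le> k \<Longrightarrow> Ck_fun A j W f"
  unfolding Ck_fun_def by (meson Ck_on_mono)

lemma Ck_fun_mult:
  "open W \<Longrightarrow> Ck_fun A k W f \<Longrightarrow> Ck_fun A k W h \<Longrightarrow> Ck_fun A k W (\<lambda>q. f q * h q)"
  unfolding Ck_fun_def
  using Ck_on_mult[OF open_chart_image, of _ W k] by (simp add: o_def)

lemma Ck_fun_const: "Ck_fun A k W (\<lambda>q. a)"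
  unfolding Ck_fun_def by (simp add: o_def Ck_on_const)

lemma Ck_fun_uminus:
  "open W \<Longrightarrow> Ck_fun A k W f \<Longrightarrow> Ck_fun A k W (\<lambda>q. - f q)"
  using Ck_fun_mult[OF _ Ck_fun_const[where a = "- 1"]] by simp

lemma dir_deriv_eq:
  "(f \<circ> param c) differentiable (at (snd c p)) \<Longrightarrow>
    dir_deriv c p a f = frechet_derivative (f \<circ> param c) (at (snd c p)) a"
  by (simp add: dir_deriv_def)

lemma dir_deriv_has_derivative:
  assumes "((f \<circ> param c) has_derivative f') (at (snd c p))"
  shows "dir_deriv c p a f = f' a"
  using assms frechet_derivative_at[OF assms] unfolding dir_deriv_def differentiable_def by metis

lemma dir_deriv_lincomb:
  "(\<lambda>f. a * dir_deriv c p u f + b * dir_deriv c p v f) = dir_deriv c p (a *\<^sub>R u + b *\<^sub>R v)"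
proof
  fix f
  show "a * dir_deriv c p u f + b * dir_deriv c p v f = dir_deriv c p (a *\<^sub>R u + b *\<^sub>R v) f"
    by (cases "(f \<circ> param c) differentiable (at (snd c p))")
       (auto simp: dir_deriv_def linear_add linear_cmul dest!: linear_frechet_derivative)
qed

lemma dir_deriv_coordinate:
  assumes "c \<in> A" "p \<in> fst c"
  shows "comp_in c i (dir_deriv c p a) = a $ i"
proof -
  have "((\<lambda>x::real^'n. x $ i) has_derivative (\<lambda>x. x $ i)) (at (snd c p))"
    by (rule bounded_linear_imp_has_derivative[OF bounded_linear_vec_nth])
  then have *: "((\<lambda>q. snd c q $ i) \<circ> param c has_derivative (\<lambda>x. x $ i)) (at (snd c p))"
    by (rule has_derivative_transform_within_open[OF _ open_chart_image[OF assms(1) open_UNIV]])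
       (use assms chart_param[OF assms(1) subset_refl] in auto)
  show ?thesis
    unfolding comp_in_def by (rule dir_deriv_has_derivative[OF *])
qed

text \<open>The chain rule for \<open>f \<circ> param d = (f \<circ> param c) \<circ> (snd c \<circ> param d)\<close>. The two sides agree only on the
  image of the overlap of the two domains, so the equality has to be localised there.\<close>

lemma differentiable_chart_change:
  assumes c: "c \<in> A" and d: "d \<in> A" and p: "p \<in> fst c" "p \<in> fst d"
    and f: "((f \<circ> param c) has_derivative f') (at (snd c p))"
  shows "((f \<circ> param d) has_derivative
          (\<lambda>b. f' (frechet_derivative (snd c \<circ> param d) (at (snd d p)) b))) (at (snd d p))"
proof -
  let ?T = "snd c \<circ> param d"
  let ?S = "snd d ` (fst c \<inter> fst d)"
  have S: "open ?S" "snd d p \<in> ?S"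
    using open_chart_image[OF d open_domain[OF c]] p by auto
  have "Ck_on (Suc 0) ?S ?T"
    using transition_smooth[OF d c, of "Suc 0"] by (simp add: Int_commute)
  from Ck_on_Suc_has_derivative[OF this S(2)]
  have T: "(?T has_derivative frechet_derivative ?T (at (snd d p))) (at (snd d p))" .
  have "((f \<circ> param c) has_derivative f') (at (?T (snd d p)))"
    using f d p by (simp add: param_chart)
  from has_derivative_compose[OF T this] show ?thesis
    by (rule has_derivative_transform_within_open[OF _ S])
       (use chart_param[OF d, of "fst c \<inter> fst d"] c in \<open>auto simp: param_chart\<close>)
qed

text \<open>A directional derivative is extended by \<open>0\<close> to functions that are not differentiable, so the
  identity needs that differentiability at \<open>p\<close> does not depend on the chart.\<close>

lemma dir_deriv_chart_change:
  assumes c: "c \<in> A" and d: "d \<in> A" and p: "p \<in> fst c" "p \<in> fst d"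
  shows "dir_deriv d p b
       = dir_deriv c p (frechet_derivative (snd c \<circ> param d) (at (snd d p)) b)"
proof
  fix f :: "'m \<Rightarrow> real"
  have diff: "(f \<circ> param c) differentiable (at (snd c p)) \<longleftrightarrow> (f \<circ> param d) differentiable (at (snd d p))"
    using differentiable_chart_change[OF assms, of f]
      differentiable_chart_change[OF d c p(2,1), of f]
    unfolding differentiable_def by blast
  show "dir_deriv d p b f
      = dir_deriv c p (frechet_derivative (snd c \<circ> param d) (at (snd d p)) b) f"
  proof (cases "(f \<circ> param c) differentiable (at (snd c p))")
    case True
    then show ?thesis
      using diff frechet_derivative_at[OF differentiable_chart_change[OF assms
            True[unfolded frechet_derivative_works]]]
      by (simp add: dir_deriv_def fun_eq_iff)
  next
    case False
    then show ?thesis using diff by (simp add: dir_deriv_def)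
  qed
qed

text \<open>Although the tangent space collects directional derivatives over all charts around \<open>p\<close>, any
  single one of them suffices, and the vector is determined by its components there.\<close>

lemma tangent_space_eq_dir_deriv:
  assumes "c \<in> A" "p \<in> fst c" "v \<in> tangent_space A p"
  shows "v = dir_deriv c p (\<chi> i. comp_in c i v)"
proof -
  obtain d b where "v = dir_deriv d p b" "d \<in> A" "p \<in> fst d"
    using assms(3) by (auto simp: tangent_space_def)
  then obtain a where a: "v = dir_deriv c p a"
    using dir_deriv_chart_change[OF assms(1)] assms(2) by metis
  then have "(\<chi> i. comp_in c i v) = a"
    using dir_deriv_coordinate[OF assms(1,2)] by (simp add: vec_eq_iff)
  with a show ?thesis by simp
qed

lemma dir_deriv_in_tangent_space:
  "c \<in> A \<Longrightarrow> p \<in> fst c \<Longrightarrow> dir_deriv c p a \<in> tangent_space A p"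
  unfolding tangent_space_def by blast

lemma tangent_space_lincomb:
  assumes "u \<in> tangent_space A p" "v \<in> tangent_space A p"
  shows "(\<lambda>f. a * u f + b * v f) \<in> tangent_space A p"
proof -
  obtain c where c: "c \<in> A" "p \<in> fst c" by (rule chart_exists)
  show ?thesis
    by (subst tangent_space_eq_dir_deriv[OF c assms(1)],
        subst tangent_space_eq_dir_deriv[OF c assms(2)])
       (use dir_deriv_in_tangent_space[OF c] in \<open>simp add: dir_deriv_lincomb\<close>)
qed

lemma tangent_space_scale:
  "u \<in> tangent_space A p \<Longrightarrow> (\<lambda>f. a * u f) \<in> tangent_space A p"
  using tangent_space_lincomb[of u p u a 0] by simp

lemma tangent_vector_product_rule:
  assumes "v \<in> tangent_space A p" "Ck_fun A 1 W f" "Ck_fun A 1 W h" "p \<in> W"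
  shows "v (\<lambda>q. f q * h q) = f p * v h + h p * v f"
proof -
  obtain c where c: "c \<in> A" "p \<in> fst c" by (rule chart_exists)
  obtain a where v: "v = dir_deriv c p a"
    using tangent_space_eq_dir_deriv[OF c assms(1)] by blast
  have f: "(f \<circ> param c) differentiable (at (snd c p))"
    and h: "(h \<circ> param c) differentiable (at (snd c p))"
    using Ck_fun_differentiable[of 0] assms c by auto
  have "((\<lambda>q. f q * h q) \<circ> param c has_derivative
      (\<lambda>b. f p * frechet_derivative (h \<circ> param c) (at (snd c p)) b
         + frechet_derivative (f \<circ> param c) (at (snd c p)) b * h p)) (at (snd c p))"
      (is "(_ has_derivative ?L) _")
    using has_derivative_mult[OF f[unfolded frechet_derivative_works] h[unfolded frechet_derivative_works]]
    by (simp add: o_def param_chart[OF c])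
  from dir_deriv_has_derivative[OF this] show ?thesis
    using f h by (simp add: v dir_deriv_eq)
qed

section \<open>Vector fields of class \<open>C\<^sup>k\<close>\<close>

lemma Ck_vfield_tangent: "Ck_vfield A k W X \<Longrightarrow> p \<in> W \<Longrightarrow> X p \<in> tangent_space A p"
  by (simp add: Ck_vfield_def)

lemma Ck_vfieldD: "Ck_vfield A k W X \<Longrightarrow> c \<in> A \<Longrightarrow>
    Ck_on k (snd c ` (W \<inter> fst c)) ((\<lambda>p. comp_in c i (X p)) \<circ> param c)"
  by (simp add: Ck_vfield_def)

lemma Ck_vfield_mono: "Ck_vfield A k W X \<Longrightarrow> j \<le> k \<Longrightarrow> Ck_vfield A j W X"
  unfolding Ck_vfield_def by (meson Ck_on_mono)

lemma Ck_vfield_subset: "Ck_vfield A k W X \<Longrightarrow> V \<subseteq> W \<Longrightarrow> Ck_vfield A k V X"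
  unfolding Ck_vfield_def by (meson Ck_on_subset Int_mono image_mono subset_refl subsetD)

lemma Ck_vfieldI:
  assumes "\<And>p. p \<in> W \<Longrightarrow> X p \<in> tangent_space A p"
    "\<And>c i. c \<in> A \<Longrightarrow> Ck_on k (snd c ` (W \<inter> fst c)) ((\<lambda>p. comp_in c i (X p)) \<circ> param c)"
  shows "Ck_vfield A k W X"
  using assms by (simp add: Ck_vfield_def)

lemma Ck_vfield_add:
  assumes "open W" "Ck_vfield A k W X" "Ck_vfield A k W Y"
  shows "Ck_vfield A k W (vf_add X Y)"
proof (rule Ck_vfieldI)
  fix p assume "p \<in> W"
  then show "vf_add X Y p \<in> tangent_space A p"
    using tangent_space_lincomb[of "X p" p "Y p" 1 1] assms
    by (simp add: vf_add_def Ck_vfield_tangent)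
next
  fix c i assume c: "c \<in> A"
  show "Ck_on k (snd c ` (W \<inter> fst c)) ((\<lambda>p. comp_in c i (vf_add X Y p)) \<circ> param c)"
    using Ck_on_add[OF open_chart_image[OF c assms(1)]
        Ck_vfieldD[OF assms(2) c, of i] Ck_vfieldD[OF assms(3) c, of i]]
    by (simp add: vf_add_def comp_in_def o_def)
qed

lemma Ck_vfield_scale:
  assumes "open W" "Ck_fun A k W h" "Ck_vfield A k W X"
  shows "Ck_vfield A k W (vf_scale h X)"
proof (rule Ck_vfieldI)
  fix p assume "p \<in> W"
  then show "vf_scale h X p \<in> tangent_space A p"
    using tangent_space_scale assms by (simp add: vf_scale_def Ck_vfield_tangent)
next
  fix c i assume c: "c \<in> A"
  show "Ck_on k (snd c ` (W \<inter> fst c)) ((\<lambda>p. comp_in c i (vf_scale h X p)) \<circ> param c)"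
    using Ck_on_mult[OF open_chart_image[OF c assms(1)]
        Ck_funD[OF assms(2) c] Ck_vfieldD[OF assms(3) c, of i]]
    by (simp add: vf_scale_def comp_in_def o_def)
qed

lemma Ck_vfield_cong:
  assumes "open W" "\<And>p. p \<in> W \<Longrightarrow> X p = X' p" "Ck_vfield A k W X"
  shows "Ck_vfield A k W X'"
proof (rule Ck_vfieldI)
  show "X' p \<in> tangent_space A p" if "p \<in> W" for p
    using Ck_vfield_tangent[OF assms(3) that] assms(2)[OF that] by simp
next
  fix c i assume c: "c \<in> A"
  show "Ck_on k (snd c ` (W \<inter> fst c)) ((\<lambda>p. comp_in c i (X' p)) \<circ> param c)"
    by (rule Ck_on_cong[OF open_chart_image[OF c assms(1)] _ Ck_vfieldD[OF assms(3) c]])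
       (use assms(2) chart_param[OF c] in fastforce)
qed

lemma Ck_vfield_diff:
  assumes "open W" "Ck_vfield A k W X" "Ck_vfield A k W Y"
  shows "Ck_vfield A k W (vf_diff X Y)"
  using Ck_vfield_add[OF assms(1,2) Ck_vfield_scale[OF assms(1) Ck_fun_const assms(3), of "- 1"]]
  by (simp add: vf_add_def vf_scale_def vf_diff_def)

text \<open>In another chart \<open>d\<close> the components of \<open>\<partial>\<^sub>j\<close> are the entries of the Jacobian matrix of
  \<open>snd d \<circ> param c\<close>, evaluated along the transition map \<open>snd c \<circ> param d\<close>.\<close>

lemma coord_field_smooth:
  assumes "c \<in> A" shows "smooth_vfield A (fst c) (coord_field c j)"
  unfolding smooth_vfield_def Ck_vfield_def
proof (intro allI conjI ballI)
  show "coord_field c j p \<in> tangent_space A p" if "p \<in> fst c" for p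
    unfolding coord_field_def using assms that by (rule dir_deriv_in_tangent_space)
next
  fix k d i assume d: "d \<in> A"
  let ?h = "(\<lambda>q. snd d q $ i) \<circ> param c"
  let ?S = "snd d ` (fst c \<inter> fst d)" and ?T = "snd c ` (fst d \<inter> fst c)"
  have h: "Ck_on (Suc k) ?T ?h"
    by (rule Ck_funD[OF coordinate_smooth[OF d] assms])
  have S: "open ?S" by (rule open_chart_image[OF d open_domain[OF assms]])
  show "Ck_on k ?S ((\<lambda>p. comp_in d i (coord_field c j p)) \<circ> param d)"
  proof (rule Ck_on_cong[OF S])
    show "Ck_on k ?S (\<lambda>y. frechet_derivative ?h (at ((snd c \<circ> param d) y)) (axis j 1))"
    proof (rule Ck_on_compose[OF S, where T = ?T])
      show "(snd c \<circ> param d) ` ?S \<subseteq> ?T" using d by (auto simp: param_chart)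
      show "Ck_on k ?T (\<lambda>x. frechet_derivative ?h (at x) (axis j 1))" using h by simp
      show "Ck_on k ?S (snd c \<circ> param d)"
        using transition_smooth[OF d assms] by (simp add: Int_commute)
    qed
    fix y assume "y \<in> ?S"
    then have "param d y \<in> fst c \<inter> fst d" using d by (auto simp: param_chart)
    then have "?h differentiable (at (snd c (param d y)))" using h by auto
    then show "frechet_derivative ?h (at ((snd c \<circ> param d) y)) (axis j 1)
        = ((\<lambda>p. comp_in d i (coord_field c j p)) \<circ> param d) y"
      by (simp add: comp_in_def coord_field_def dir_deriv_def)
  qed
qed

lemma vf_apply_in_chart:
  assumes "c \<in> A" "Ck_vfield A k W X" "Ck_fun A (Suc l) W f" "x \<in> snd c ` (W \<inter> fst c)"
  shows "(vf_apply X f \<circ> param c) x = (\<Sum>i\<in>UNIV. ((\<lambda>p. comp_in c i (X p)) \<circ> param c) x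
           * frechet_derivative (f \<circ> param c) (at x) (axis i 1))"
proof -
  define p where "p = param c x"
  have p: "p \<in> W" "p \<in> fst c" "snd c p = x"
    using chart_param[OF assms(1) _ assms(4)] by (auto simp: p_def)
  have diff: "(f \<circ> param c) differentiable (at x)"
    using Ck_fun_differentiable[OF assms(3,1) p(1,2)] p(3) by simp
  have "X p f = dir_deriv c p (\<chi> i. comp_in c i (X p)) f"
    using tangent_space_eq_dir_deriv[OF assms(1) p(2) Ck_vfield_tangent[OF assms(2) p(1)]] by metis
  also have "\<dots> = frechet_derivative (f \<circ> param c) (at x) (\<chi> i. comp_in c i (X p))"
    using diff p by (simp add: dir_deriv_def)
  also have "\<dots> = (\<Sum>i\<in>UNIV. comp_in c i (X p) * frechet_derivative (f \<circ> param c) (at x) (axis i 1))"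
    by (subst linear_axis_expansion[OF linear_frechet_derivative[OF diff]]) simp
  finally show ?thesis by (simp add: vf_apply_def p_def)
qed

lemma Ck_fun_vf_apply:
  assumes "open W" "Ck_vfield A k W X" "Ck_fun A (Suc k) W f"
  shows "Ck_fun A k W (vf_apply X f)"
  unfolding Ck_fun_def
proof
  fix c assume c: "c \<in> A"
  let ?S = "snd c ` (W \<inter> fst c)"
  have S: "open ?S" by (rule open_chart_image[OF c assms(1)])
  have "Ck_on k ?S (\<lambda>x. \<Sum>i\<in>UNIV. ((\<lambda>p. comp_in c i (X p)) \<circ> param c) x
           * frechet_derivative (f \<circ> param c) (at x) (axis i 1))"
    using Ck_funD[OF assms(3) c]
    by (intro Ck_on_sum[OF S] Ck_on_mult[OF S] Ck_vfieldD[OF assms(2) c]) simp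
  then show "Ck_on k ?S (vf_apply X f \<circ> param c)"
    by (rule Ck_on_cong[OF S, rotated]) (rule vf_apply_in_chart[OF c assms(2,3), symmetric])
qed

section \<open>Commutators and the Lie bracket\<close>

text \<open>Differentiating \<open>Y f = (\<Sum>\<^sub>i Y\<^sup>i \<partial>\<^sub>i f)\<close> along \<open>X\<close> gives a first-order term with coefficients \<open>X(Y\<^sup>i)\<close> and
  the Hessian term \<open>\<Sum>\<^sub>i\<^sub>j Y\<^sup>i X\<^sup>j \<partial>\<^sub>j\<partial>\<^sub>i f\<close>. They are kept apart because only the first one survives in the
  commutator.\<close>

lemma vf_apply_vf_apply_in_chart:
  assumes W: "open W" and X: "X p \<in> tangent_space A p" and Y: "Ck_vfield A 1 W Y"
    and f: "Ck_fun A 2 W f" and c: "c \<in> A" and p: "p \<in> W" "p \<in> fst c"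
  defines "F \<equiv> f \<circ> param c"
  shows "X p (vf_apply Y f) =
    dir_deriv c p (\<chi> i. X p (\<lambda>q. comp_in c i (Y q))) f
    + (\<Sum>i\<in>UNIV. \<Sum>j\<in>UNIV. comp_in c i (Y p) * comp_in c j (X p) *
        frechet_derivative (\<lambda>y. frechet_derivative F (at y) (axis i 1)) (at (snd c p)) (axis j 1))"
proof -
  define x where "x = snd c p"
  let ?S = "snd c ` (W \<inter> fst c)"
  let ?a = "\<chi> i. comp_in c i (X p)"
  let ?Y = "\<lambda>i. (\<lambda>q. comp_in c i (Y q)) \<circ> param c"
  let ?dF = "\<lambda>i y. frechet_derivative F (at y) (axis i 1)"
  have S: "open ?S" "x \<in> ?S" using open_chart_image[OF c W] p by (auto simp: x_def)
  have F: "Ck_on (Suc (Suc 0)) ?S F"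
    using Ck_funD[OF f c] by (simp add: F_def numeral_2_eq_2)
  have f': "Ck_fun A (Suc (Suc 0)) W f" using f by (simp add: numeral_2_eq_2)
  have dF: "Ck_on (Suc 0) ?S (?dF i)" for i using F by simp
  have YS: "Ck_on (Suc 0) ?S (?Y i)" for i using Ck_vfieldD[OF Y c] by simp
  have Xp: "X p h = h' ?a" if "((h \<circ> param c) has_derivative h') (at x)" for h h'
    using tangent_space_eq_dir_deriv[OF c p(2) X] dir_deriv_has_derivative that
    unfolding x_def by metis
  have XY: "X p (\<lambda>q. comp_in c i (Y q)) = frechet_derivative (?Y i) (at x) ?a" for i
    by (rule Xp[OF Ck_on_Suc_has_derivative[OF YS S(2)]])
  have "((\<lambda>y. \<Sum>i\<in>UNIV. ?Y i y * ?dF i y) has_derivative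
      (\<lambda>b. \<Sum>i\<in>UNIV. ?Y i x * frechet_derivative (?dF i) (at x) b
                    + frechet_derivative (?Y i) (at x) b * ?dF i x)) (at x)"
    by (intro has_derivative_sum has_derivative_mult
        Ck_on_Suc_has_derivative[OF dF S(2)] Ck_on_Suc_has_derivative[OF YS S(2)])
  then have der: "(vf_apply Y f \<circ> param c has_derivative
      (\<lambda>b. \<Sum>i\<in>UNIV. ?Y i x * frechet_derivative (?dF i) (at x) b
                    + frechet_derivative (?Y i) (at x) b * ?dF i x)) (at x)"
    by (rule has_derivative_transform_within_open[OF _ S])
       (use vf_apply_in_chart[OF c Y f'] in \<open>auto simp: F_def\<close>)
  have "X p (vf_apply Y f) = (\<Sum>i\<in>UNIV. ?Y i x * frechet_derivative (?dF i) (at x) ?a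
                    + frechet_derivative (?Y i) (at x) ?a * ?dF i x)"
    by (rule Xp[OF der])
  also have "\<dots> = (\<Sum>i\<in>UNIV. frechet_derivative (?Y i) (at x) ?a * ?dF i x)
      + (\<Sum>i\<in>UNIV. comp_in c i (Y p) * frechet_derivative (?dF i) (at x) ?a)"
    by (simp add: sum.distrib x_def param_chart[OF c p(2)])
  also have "(\<Sum>i\<in>UNIV. frechet_derivative (?Y i) (at x) ?a * ?dF i x)
      = dir_deriv c p (\<chi> i. X p (\<lambda>q. comp_in c i (Y q))) f"
  proof -
    have diff: "F differentiable (at x)" using Ck_on_Suc_has_derivative[OF F S(2)] unfolding differentiable_def by blast
    then show ?thesis
      using linear_axis_expansion[OF linear_frechet_derivative[OF diff],
          of "\<chi> i. X p (\<lambda>q. comp_in c i (Y q))"]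
      by (simp add: dir_deriv_def F_def[symmetric] x_def[symmetric] XY)
  qed
  also have "(\<Sum>i\<in>UNIV. comp_in c i (Y p) * frechet_derivative (?dF i) (at x) ?a)
      = (\<Sum>i\<in>UNIV. \<Sum>j\<in>UNIV. comp_in c i (Y p) * comp_in c j (X p)
          * frechet_derivative (?dF i) (at x) (axis j 1))"
  proof (intro sum.cong refl)
    fix i
    have "?dF i differentiable (at x)" using dF[of i] S by auto
    from linear_axis_expansion[OF linear_frechet_derivative[OF this], of ?a]
    show "comp_in c i (Y p) * frechet_derivative (?dF i) (at x) ?a
        = (\<Sum>j\<in>UNIV. comp_in c i (Y p) * comp_in c j (X p)
          * frechet_derivative (?dF i) (at x) (axis j 1))"
      by (simp add: sum_distrib_left mult.assoc)
  qed
  finally show ?thesis by (simp add: x_def)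
qed

text \<open>The Hessian terms of \<open>X(Y f)\<close> and \<open>Y(X f)\<close> are equal by the symmetry of second derivatives, so the
  commutator is a tangent vector. Class \<open>C\<^sup>2\<close> is enough for \<open>f\<close>.\<close>

lemma commutator_in_chart:
  assumes W: "open W" and X: "Ck_vfield A 1 W X" and Y: "Ck_vfield A 1 W Y"
    and f: "Ck_fun A 2 W f" and c: "c \<in> A" and p: "p \<in> W" "p \<in> fst c"
  shows "X p (vf_apply Y f) - Y p (vf_apply X f) =
    dir_deriv c p (\<chi> i. X p (\<lambda>q. comp_in c i (Y q)) - Y p (\<lambda>q. comp_in c i (X q))) f"
proof -
  let ?x = "snd c p" and ?F = "f \<circ> param c"
  let ?H = "\<lambda>i j. frechet_derivative (\<lambda>y. frechet_derivative ?F (at y) (axis i 1)) (at ?x) (axis j 1)"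
  have "Ck_on (Suc (Suc 0)) (snd c ` (W \<inter> fst c)) ?F"
    using Ck_funD[OF f c] by (simp add: numeral_2_eq_2)
  then have sym: "?H i j = ?H j i" for i j
    using symmetric_second_derivative[OF open_chart_image[OF c W]] p by blast
  have "(\<Sum>i\<in>UNIV. \<Sum>j\<in>UNIV. comp_in c i (Y p) * comp_in c j (X p) * ?H i j)
      = (\<Sum>j\<in>UNIV. \<Sum>i\<in>UNIV. comp_in c i (Y p) * comp_in c j (X p) * ?H i j)"
    by (rule sum.swap)
  also have "\<dots> = (\<Sum>i\<in>UNIV. \<Sum>j\<in>UNIV. comp_in c i (X p) * comp_in c j (Y p) * ?H i j)"
    by (intro sum.cong refl) (use sym in \<open>metis mult.commute\<close>)
  finally have "X p (vf_apply Y f) - Y p (vf_apply X f)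
      = 1 * dir_deriv c p (\<chi> i. X p (\<lambda>q. comp_in c i (Y q))) f
        + (- 1) * dir_deriv c p (\<chi> i. Y p (\<lambda>q. comp_in c i (X q))) f"
    using vf_apply_vf_apply_in_chart[where X = X and p = p, OF W Ck_vfield_tangent[OF X p(1)] Y f c p]
      vf_apply_vf_apply_in_chart[where X = Y and p = p, OF W Ck_vfield_tangent[OF Y p(1)] X f c p] by simp
  also have "\<dots> = dir_deriv c p ((1::real) *\<^sub>R (\<chi> i. X p (\<lambda>q. comp_in c i (Y q)))
        + (- 1) *\<^sub>R (\<chi> i. Y p (\<lambda>q. comp_in c i (X q)))) f"
    by (simp only: dir_deriv_lincomb[symmetric])
  also have "(1::real) *\<^sub>R (\<chi> i. X p (\<lambda>q. comp_in c i (Y q)))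
        + (- 1) *\<^sub>R (\<chi> i. Y p (\<lambda>q. comp_in c i (X q)))
      = (\<chi> i. X p (\<lambda>q. comp_in c i (Y q)) - Y p (\<lambda>q. comp_in c i (X q)))"
    by (simp add: vec_eq_iff)
  finally show ?thesis .
qed

text \<open>The bracket is the tangent vector characterised by its action on smooth functions. The commutator
  in a chart satisfies this characterisation, and two tangent vectors that do so agree on the
  smooth coordinate functions and hence coincide. The point is that the formula extends from smooth
  functions to functions of class \<open>C\<^sup>2\<close>, such as the scaling function.\<close>

lemma lie_bracket_eq_commutator:
  assumes W: "open W" and X: "Ck_vfield A 1 W X" and Y: "Ck_vfield A 1 W Y"
    and f: "Ck_fun A 2 W f" and p: "p \<in> W"
  shows "lie_bracket A X Y p f = X p (vf_apply Y f) - Y p (vf_apply X f)"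
proof -
  obtain c where c: "c \<in> A" "p \<in> fst c" by (rule chart_exists)
  define w where "w = dir_deriv c p
    (\<chi> i. X p (\<lambda>q. comp_in c i (Y q)) - Y p (\<lambda>q. comp_in c i (X q)))"
  have w: "w h = X p (vf_apply Y h) - Y p (vf_apply X h)"
    if "open V" "p \<in> V" "Ck_fun A 2 V h" for V h
    unfolding w_def
    by (rule commutator_in_chart[where W = "V \<inter> W", symmetric])
       (use that c p W Ck_vfield_subset[OF X, of "V \<inter> W"] Ck_vfield_subset[OF Y, of "V \<inter> W"]
        in \<open>auto intro: Ck_fun_subset\<close>)
  have "lie_bracket A X Y p = w"
    unfolding lie_bracket_def
  proof (rule the_equality)
    show "w \<in> tangent_space A p \<and> (\<forall>V f. open V \<and> p \<in> V \<and> (\<forall>k. Ck_fun A k V f) \<longrightarrow>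
           w f = X p (vf_apply Y f) - Y p (vf_apply X f))"
      using w by (auto simp: w_def intro: dir_deriv_in_tangent_space[OF c])
  next
    fix w' assume w': "w' \<in> tangent_space A p \<and> (\<forall>V f. open V \<and> p \<in> V \<and> (\<forall>k. Ck_fun A k V f) \<longrightarrow>
           w' f = X p (vf_apply Y f) - Y p (vf_apply X f))"
    have "comp_in c i w' = comp_in c i w" for i
      unfolding comp_in_def
      using w' w c open_domain[OF c(1)] coordinate_smooth[OF c(1)] by metis
    moreover have "w \<in> tangent_space A p"
      by (simp add: w_def dir_deriv_in_tangent_space[OF c])
    ultimately show "w' = w"
      using tangent_space_eq_dir_deriv[OF c, of w] tangent_space_eq_dir_deriv[OF c, of w'] w'
      by simp
  qed
  with w[OF W p f] show ?thesis by simp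
qed

end

section \<open>Covariant derivatives of rescaled fields\<close>

locale torsion_free_connection = smooth_atlas A
  for A :: "('m::{t2_space, second_countable_topology}, 'n::finite) chart set" +
  fixes D :: "'m conn"
  assumes affine: "affine_connection A D" and torsion_free: "torsion_free A D"
begin

lemma D_Ck: "open W \<Longrightarrow> Ck_vfield A k W X \<Longrightarrow> Ck_vfield A (Suc k) W Y \<Longrightarrow> Ck_vfield A k W (D X Y)"
  using affine[unfolded affine_connection_def, THEN spec, THEN mp, THEN conjunct1] by blast

lemma D_cong:
  "open W \<Longrightarrow> Ck_vfield A 0 W X \<Longrightarrow> Ck_vfield A 1 W Y \<Longrightarrow> (\<And>q. q \<in> W \<Longrightarrow> X' q = X q) \<Longrightarrow>
    (\<And>q. q \<in> W \<Longrightarrow> Y' q = Y q) \<Longrightarrow> p \<in> W \<Longrightarrow> D X' Y' p = D X Y p"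
  using affine[unfolded affine_connection_def, THEN spec, THEN mp, THEN conjunct2, THEN conjunct1]
  by blast

lemma D_add_left:
  assumes "open W" "Ck_vfield A 0 W X" "Ck_vfield A 0 W X'" "Ck_vfield A 1 W Y" "p \<in> W"
  shows "D (vf_add X X') Y p f = D X Y p f + D X' Y p f"
proof -
  have "D (vf_add X X') Y p = vf_add (D X Y) (D X' Y) p"
    using affine[unfolded affine_connection_def, THEN spec, THEN mp, OF assms(1),
        THEN conjunct2, THEN conjunct2, THEN conjunct1] assms(2-) by blast
  then show ?thesis by (simp add: vf_add_def)
qed

lemma D_scale_left:
  assumes "open W" "Ck_fun A 0 W h" "Ck_vfield A 0 W X" "Ck_vfield A 1 W Y" "p \<in> W"
  shows "D (vf_scale h X) Y p f = h p * D X Y p f"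
proof -
  have "D (vf_scale h X) Y p = vf_scale h (D X Y) p"
    using affine[unfolded affine_connection_def, THEN spec, THEN mp, OF assms(1),
        THEN conjunct2, THEN conjunct2, THEN conjunct2, THEN conjunct1] assms(2-) by blast
  then show ?thesis by (simp add: vf_scale_def)
qed

lemma D_add_right:
  assumes "open W" "Ck_vfield A 0 W X" "Ck_vfield A 1 W Y" "Ck_vfield A 1 W Y'" "p \<in> W"
  shows "D X (vf_add Y Y') p f = D X Y p f + D X Y' p f"
proof -
  have "D X (vf_add Y Y') p = vf_add (D X Y) (D X Y') p"
    using affine[unfolded affine_connection_def, THEN spec, THEN mp, OF assms(1),
        THEN conjunct2, THEN conjunct2, THEN conjunct2, THEN conjunct2, THEN conjunct1] assms(2-)
    by blast
  then show ?thesis by (simp add: vf_add_def)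
qed

lemma D_Leibniz:
  assumes "open W" "Ck_fun A 1 W h" "Ck_vfield A 0 W X" "Ck_vfield A 1 W Y" "p \<in> W"
  shows "D X (vf_scale h Y) p f = X p h * Y p f + h p * D X Y p f"
proof -
  have "D X (vf_scale h Y) p = vf_add (vf_scale (vf_apply X h) Y) (vf_scale h (D X Y)) p"
    using affine[unfolded affine_connection_def, THEN spec, THEN mp, OF assms(1),
        THEN conjunct2, THEN conjunct2, THEN conjunct2, THEN conjunct2, THEN conjunct2] assms(2-)
    by blast
  then show ?thesis by (simp add: vf_add_def vf_scale_def vf_apply_def)
qed

lemma lie_bracket_eq_D:
  "open W \<Longrightarrow> Ck_vfield A 1 W X \<Longrightarrow> Ck_vfield A 1 W Y \<Longrightarrow> p \<in> W \<Longrightarrow>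
    lie_bracket A X Y p = vf_diff (D X Y) (D Y X) p"
  using torsion_free unfolding torsion_free_def by metis

text \<open>Vanishing torsion writes the bracket as a difference of covariant derivatives, and from there its
  regularity and its behaviour under rescaling follow without returning to charts.\<close>

lemma Ck_vfield_lie_bracket:
  assumes "open W" "Ck_vfield A (Suc k) W X" "Ck_vfield A (Suc k) W Y"
  shows "Ck_vfield A k W (lie_bracket A X Y)"
proof (rule Ck_vfield_cong[OF assms(1)])
  note low = Ck_vfield_mono[OF assms(2)] Ck_vfield_mono[OF assms(3)]
  show "vf_diff (D X Y) (D Y X) p = lie_bracket A X Y p" if "p \<in> W" for p
    using lie_bracket_eq_D[OF assms(1) low that] by simp
  show "Ck_vfield A k W (vf_diff (D X Y) (D Y X))"
    by (intro Ck_vfield_diff D_Ck assms low) simp_all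
qed

text \<open>Written as a sum of two multiples of fields whose coefficients have a known regularity, the result
  can be differentiated again by the rules for a connection.\<close>

lemma D_scaled_fields:
  assumes W: "open W" and e: "Ck_fun A 1 W e" and X: "Ck_vfield A 0 W X"
    and Y: "Ck_vfield A 1 W Y" and p: "p \<in> W"
  shows "D (vf_scale e X) (vf_scale e Y) p
    = vf_add (vf_scale (\<lambda>q. e q * vf_apply X e q) Y) (vf_scale (\<lambda>q. e q * e q) (D X Y)) p"
proof
  fix f
  have "D (vf_scale e X) (vf_scale e Y) p f = e p * D X (vf_scale e Y) p f"
    using Ck_fun_mono[OF e] by (intro D_scale_left[OF W _ X Ck_vfield_scale[OF W e Y] p]) simp
  also have "\<dots> = e p * (X p e * Y p f + e p * D X Y p f)"
    by (simp only: D_Leibniz[OF W e X Y p])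
  finally show "D (vf_scale e X) (vf_scale e Y) p f
    = vf_add (vf_scale (\<lambda>q. e q * vf_apply X e q) Y) (vf_scale (\<lambda>q. e q * e q) (D X Y)) p f"
    by (simp add: vf_scale_def vf_add_def vf_apply_def algebra_simps)
qed

text \<open>The Leibniz rule applied to \<open>D\<^bsub>eY\<^esub>(eZ) = e Y(e) Z + e\<^sup>2 D\<^bsub>Y\<^esub> Z\<close>. The factor \<open>Y(e)\<close> is differentiated once more,
  and this is where \<open>e\<close> has to be of class \<open>C\<^sup>2\<close>. The terms that are symmetric in \<open>X\<close> and \<open>Y\<close>, such as
  \<open>Y(e) X(e) Z\<close>, drop out of the curvature.\<close>

lemma second_covariant_derivative_scaled:
  assumes W: "open W" and e: "Ck_fun A 2 W e" and X: "Ck_vfield A 0 W X"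
    and Y: "Ck_vfield A 1 W Y" and Z: "Ck_vfield A 2 W Z" and p: "p \<in> W"
  shows "D (vf_scale e X) (D (vf_scale e Y) (vf_scale e Z)) p f
    = e p * ((e p * X p (vf_apply Y e) + Y p e * X p e) * Z p f + e p * Y p e * D X Z p f
           + 2 * e p * X p e * D Y Z p f + e p * e p * D X (D Y Z) p f)"
proof -
  let ?h = "\<lambda>q. e q * vf_apply Y e q" and ?k = "\<lambda>q. e q * e q"
  note e_low = Ck_fun_mono[OF e] and Z_low = Ck_vfield_mono[OF Z]
  have e1: "Ck_fun A 1 W e" and e0: "Ck_fun A 0 W e" and Z1: "Ck_vfield A 1 W Z"
    using e_low Z_low by simp_all
  have Y0: "Ck_vfield A 0 W Y" using Ck_vfield_mono[OF Y] by simp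
  have Ye: "Ck_fun A 1 W (vf_apply Y e)"
    using Ck_fun_vf_apply[OF W Y] e by (simp add: numeral_2_eq_2)
  have h: "Ck_fun A 1 W ?h" and k: "Ck_fun A 1 W ?k"
    by (intro Ck_fun_mult[OF W] e1 Ye)+
  have DYZ: "Ck_vfield A 1 W (D Y Z)"
    using D_Ck[OF W Y] Z by (simp add: numeral_2_eq_2)
  have hZ: "Ck_vfield A 1 W (vf_scale ?h Z)" and kDYZ: "Ck_vfield A 1 W (vf_scale ?k (D Y Z))"
    by (intro Ck_vfield_scale[OF W] h k Z1 DYZ)+
  have inner: "Ck_vfield A 1 W (vf_add (vf_scale ?h Z) (vf_scale ?k (D Y Z)))"
    by (rule Ck_vfield_add[OF W hZ kDYZ])
  have Xh: "X p ?h = e p * X p (vf_apply Y e) + Y p e * X p e"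
    unfolding tangent_vector_product_rule[OF Ck_vfield_tangent[OF X p] e1 Ye p]
    by (simp add: vf_apply_def)
  have Xk: "X p ?k = e p * X p e + e p * X p e"
    by (rule tangent_vector_product_rule[OF Ck_vfield_tangent[OF X p] e1 e1 p])
  have "D (vf_scale e X) (D (vf_scale e Y) (vf_scale e Z)) p
      = D (vf_scale e X) (vf_add (vf_scale ?h Z) (vf_scale ?k (D Y Z))) p"
    by (rule D_cong[OF W Ck_vfield_scale[OF W e0 X] inner refl _ p])
       (rule D_scaled_fields[OF W e1 Y0 Z1])
  then have "D (vf_scale e X) (D (vf_scale e Y) (vf_scale e Z)) p f
      = D (vf_scale e X) (vf_add (vf_scale ?h Z) (vf_scale ?k (D Y Z))) p f"
    by (rule fun_cong)
  also have "\<dots> = e p * D X (vf_add (vf_scale ?h Z) (vf_scale ?k (D Y Z))) p f"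
    by (rule D_scale_left[OF W e0 X inner p])
  also have "\<dots> = e p * (D X (vf_scale ?h Z) p f + D X (vf_scale ?k (D Y Z)) p f)"
    by (simp only: D_add_right[OF W X hZ kDYZ p])
  also have "\<dots> = e p * ((X p ?h * Z p f + ?h p * D X Z p f)
                      + (X p ?k * D Y Z p f + ?k p * D X (D Y Z) p f))"
    by (simp only: D_Leibniz[OF W h X Z1 p] D_Leibniz[OF W k X DYZ p])
  also have "\<dots> = e p * ((e p * X p (vf_apply Y e) + Y p e * X p e) * Z p f + e p * Y p e * D X Z p f
           + 2 * e p * X p e * D Y Z p f + e p * e p * D X (D Y Z) p f)"
    unfolding Xh Xk by (simp add: vf_apply_def algebra_simps)
  finally show ?thesis .
qed

text \<open>Antisymmetrise the formula for \<open>D\<^bsub>eX\<^esub>(eY)\<close>.\<close>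

lemma lie_bracket_scaled:
  assumes W: "open W" and e: "Ck_fun A 1 W e" and X: "Ck_vfield A 1 W X"
    and Y: "Ck_vfield A 1 W Y" and p: "p \<in> W"
  shows "lie_bracket A (vf_scale e X) (vf_scale e Y) p
    = vf_add (vf_scale (\<lambda>q. e q * e q) (lie_bracket A X Y))
        (vf_add (vf_scale (\<lambda>q. e q * vf_apply X e q) Y)
                (vf_scale (\<lambda>q. - (e q * vf_apply Y e q)) X)) p"
proof -
  have X0: "Ck_vfield A 0 W X" and Y0: "Ck_vfield A 0 W Y"
    using Ck_vfield_mono[OF X] Ck_vfield_mono[OF Y] by simp_all
  have "lie_bracket A (vf_scale e X) (vf_scale e Y) p
      = vf_diff (D (vf_scale e X) (vf_scale e Y)) (D (vf_scale e Y) (vf_scale e X)) p"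
    by (rule lie_bracket_eq_D[OF W Ck_vfield_scale[OF W e X] Ck_vfield_scale[OF W e Y] p])
  then show ?thesis
    using D_scaled_fields[OF W e X0 Y p] D_scaled_fields[OF W e Y0 X p] lie_bracket_eq_D[OF W X Y p]
    by (simp add: vf_diff_def vf_add_def vf_scale_def algebra_simps)
qed

text \<open>Both correction terms of the curvature occur here: \<open>[eX, eY]\<close> contributes the first derivatives of
  \<open>e\<close>, and its action on the factor \<open>e\<close> of \<open>eZ\<close> contributes \<open>e\<^sup>2 [X,Y](e) Z\<close>, the
  commutator of the second derivatives of \<open>e\<close>.\<close>

lemma D_lie_bracket_scaled:
  assumes W: "open W" and e: "Ck_fun A 2 W e" and X: "Ck_vfield A 1 W X"
    and Y: "Ck_vfield A 1 W Y" and Z: "Ck_vfield A 1 W Z" and p: "p \<in> W"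
  shows "D (lie_bracket A (vf_scale e X) (vf_scale e Y)) (vf_scale e Z) p f
    = e p * e p * (X p (vf_apply Y e) - Y p (vf_apply X e)) * Z p f
      + e p * (e p * e p * D (lie_bracket A X Y) Z p f
               + e p * X p e * D Y Z p f - e p * Y p e * D X Z p f)"
proof -
  let ?L = "lie_bracket A X Y"
  let ?a = "\<lambda>q. e q * e q" and ?b = "\<lambda>q. e q * vf_apply X e q" and ?c = "\<lambda>q. - (e q * vf_apply Y e q)"
  let ?B = "vf_add (vf_scale ?a ?L) (vf_add (vf_scale ?b Y) (vf_scale ?c X))"
  have e1: "Ck_fun A 1 W e" and e0: "Ck_fun A 0 W e"
    using Ck_fun_mono[OF e] by simp_all
  have X0: "Ck_vfield A 0 W X" and Y0: "Ck_vfield A 0 W Y"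
    using Ck_vfield_mono[OF X] Ck_vfield_mono[OF Y] by simp_all
  have L0: "Ck_vfield A 0 W ?L"
    using Ck_vfield_lie_bracket[OF W] X Y by simp
  have "Ck_fun A 0 W (vf_apply X e)" "Ck_fun A 0 W (vf_apply Y e)"
    using Ck_fun_vf_apply[OF W X0] Ck_fun_vf_apply[OF W Y0] e1 by simp_all
  then have a: "Ck_fun A 0 W ?a" and b: "Ck_fun A 0 W ?b" and c: "Ck_fun A 0 W ?c"
    by (simp_all add: Ck_fun_mult[OF W] Ck_fun_uminus[OF W] e0)
  note summands = Ck_vfield_scale[OF W a L0] Ck_vfield_scale[OF W b Y0] Ck_vfield_scale[OF W c X0]
  have B: "Ck_vfield A 0 W ?B"
    by (intro Ck_vfield_add[OF W] summands)
  have Be: "?B p e = e p * e p * (X p (vf_apply Y e) - Y p (vf_apply X e))"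
    unfolding lie_bracket_eq_commutator[OF W X Y e p, symmetric]
    by (simp add: vf_add_def vf_scale_def vf_apply_def)
  have DB: "D ?B Z p f = e p * e p * D ?L Z p f
      + (e p * X p e * D Y Z p f - e p * Y p e * D X Z p f)"
    unfolding D_add_left[OF W summands(1) Ck_vfield_add[OF W summands(2,3)] Z p]
      D_add_left[OF W summands(2,3) Z p] D_scale_left[OF W a L0 Z p]
      D_scale_left[OF W b Y0 Z p] D_scale_left[OF W c X0 Z p]
    by (simp add: vf_apply_def)
  have "D (lie_bracket A (vf_scale e X) (vf_scale e Y)) (vf_scale e Z) p = D ?B (vf_scale e Z) p"
    by (rule D_cong[OF W B Ck_vfield_scale[OF W e1 Z] _ refl p])
       (rule lie_bracket_scaled[OF W e1 X Y])
  then have "D (lie_bracket A (vf_scale e X) (vf_scale e Y)) (vf_scale e Z) p f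
      = D ?B (vf_scale e Z) p f"
    by (rule fun_cong)
  also have "\<dots> = ?B p e * Z p f + e p * D ?B Z p f"
    by (rule D_Leibniz[OF W e1 B Z p])
  finally show ?thesis
    unfolding Be DB by simp
qed

section \<open>Curvature of rescaled fields\<close>

text \<open>Every term with a derivative of \<open>e\<close> in \<open>D\<^bsub>eX\<^esub> D\<^bsub>eY\<^esub>(eZ) - D\<^bsub>eY\<^esub> D\<^bsub>eX\<^esub>(eZ)\<close> is matched by one in
  \<open>D\<^bsub>[eX,eY]\<^esub>(eZ)\<close>; what remains is \<open>e\<^sup>3 R(X,Y)Z\<close>.\<close>

lemma curvature_scaled:
  assumes W: "open W" and e: "Ck_fun A 2 W e" and X: "Ck_vfield A 1 W X"
    and Y: "Ck_vfield A 1 W Y" and Z: "Ck_vfield A 2 W Z" and p: "p \<in> W"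
  shows "curvature A D (vf_scale e X) (vf_scale e Y) (vf_scale e Z) p
    = (\<lambda>f. e p ^ 3 * curvature A D X Y Z p f)"
proof
  fix f
  have X0: "Ck_vfield A 0 W X" and Y0: "Ck_vfield A 0 W Y" and Z1: "Ck_vfield A 1 W Z"
    using Ck_vfield_mono[OF X] Ck_vfield_mono[OF Y] Ck_vfield_mono[OF Z] by simp_all
  show "curvature A D (vf_scale e X) (vf_scale e Y) (vf_scale e Z) p f
      = e p ^ 3 * curvature A D X Y Z p f"
    unfolding curvature_def vf_diff_def
      second_covariant_derivative_scaled[OF W e X0 Y Z p]
      second_covariant_derivative_scaled[OF W e Y0 X Z p]
      D_lie_bracket_scaled[OF W e X Y Z1 p]
    by (simp add: algebra_simps power3_eq_cube)
qed

text \<open>This places \<open>R(X,Y)Z\<close> in the tangent spaces, on which the metric is bilinear.\<close>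

lemma Ck_vfield_curvature:
  assumes W: "open W" and X: "Ck_vfield A 1 W X" and Y: "Ck_vfield A 1 W Y"
    and Z: "Ck_vfield A 2 W Z"
  shows "Ck_vfield A 0 W (curvature A D X Y Z)"
proof -
  have X0: "Ck_vfield A 0 W X" and Y0: "Ck_vfield A 0 W Y" and Z1: "Ck_vfield A 1 W Z"
    using Ck_vfield_mono[OF X] Ck_vfield_mono[OF Y] Ck_vfield_mono[OF Z] by simp_all
  have "Ck_vfield A 1 W (D X Z)" "Ck_vfield A 1 W (D Y Z)"
    using D_Ck[OF W X] D_Ck[OF W Y] Z by (simp_all add: numeral_2_eq_2)
  moreover have "Ck_vfield A 0 W (lie_bracket A X Y)"
    using Ck_vfield_lie_bracket[OF W] X Y by simp
  ultimately show ?thesis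
    unfolding curvature_def using Z1
    by (intro Ck_vfield_diff[OF W] D_Ck[OF W X0] D_Ck[OF W Y0] D_Ck[OF W, of 0 "lie_bracket A X Y"])
       simp_all
qed

text \<open>Numerator and denominator both scale by \<open>e\<^sup>4\<close>: the former has \<open>e\<^sup>3\<close> from the curvature and \<open>e\<close> from
  the vector with which it is paired, the latter is quartic in the fields.\<close>

lemma stoch_sectional_eq:
  assumes g: "riemannian_metric A g" and W: "open W" and e: "Ck_fun A 2 W e"
    and X: "Ck_vfield A 2 W X" and Y: "Ck_vfield A 2 W Y" and p: "p \<in> W" and "e p \<noteq> 0"
  shows "stoch_sectional A g D e X Y p = sectional A g D X Y p"
proof -
  have X1: "Ck_vfield A 1 W X" and Y1: "Ck_vfield A 1 W Y"
    using Ck_vfield_mono[OF X] Ck_vfield_mono[OF Y] by simp_all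
  let ?T = "tangent_space A p"
  have scale_left: "g p (\<lambda>f. a * u f) v = a * g p u v" if "u \<in> ?T" "v \<in> ?T" for a u v
  proof -
    have "g p (\<lambda>f. a * u f + 0 * u f) v = a * g p u v + 0 * g p u v"
      using g that unfolding riemannian_metric_def by blast
    then show ?thesis by simp
  qed
  have sym: "g p u v = g p v u" if "u \<in> ?T" "v \<in> ?T" for u v
    using g that unfolding riemannian_metric_def by blast
  have scale_both: "g p (\<lambda>f. a * u f) (\<lambda>f. b * v f) = a * b * g p u v"
    if "u \<in> ?T" "v \<in> ?T" for a b u v
    using that scale_left[of u "\<lambda>f. b * v f" a] scale_left[of v u b] sym[of u v]
      sym[of u "\<lambda>f. b * v f"] tangent_space_scale[of v p b] by simp
  have T: "X p \<in> ?T" "Y p \<in> ?T" "curvature A D X Y X p \<in> ?T"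
    using Ck_vfield_tangent[OF X p] Ck_vfield_tangent[OF Y p]
      Ck_vfield_tangent[OF Ck_vfield_curvature[OF W X1 Y1 X] p] by auto
  have "curvature4 A g D (vf_scale e X) (vf_scale e Y) (vf_scale e X) (vf_scale e Y) p
      = g p (\<lambda>f. e p ^ 3 * curvature A D X Y X p f) (\<lambda>f. e p * Y p f)"
    unfolding curvature4_def inner_vf_def curvature_scaled[OF W e X1 Y1 X p]
    by (simp add: vf_scale_def)
  also have "\<dots> = e p ^ 4 * curvature4 A g D X Y X Y p"
    by (simp add: scale_both[OF T(3,2)] curvature4_def inner_vf_def power_numeral_reduce)
  finally have num: "curvature4 A g D (vf_scale e X) (vf_scale e Y) (vf_scale e X) (vf_scale e Y) p
      = e p ^ 4 * curvature4 A g D X Y X Y p" .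
  have inner: "inner_vf g (vf_scale e U) (vf_scale e V) p = (e p)\<^sup>2 * inner_vf g U V p"
    if "U p \<in> ?T" "V p \<in> ?T" for U V
    by (simp add: inner_vf_def vf_scale_def scale_both[OF that] power2_eq_square)
  have "stoch_sectional A g D e X Y p = e p ^ 4 * curvature4 A g D X Y X Y p /
      (e p ^ 4 * (inner_vf g X X p * inner_vf g Y Y p - (inner_vf g X Y p)\<^sup>2))"
    unfolding stoch_sectional_def Let_def num
    by (simp add: inner T algebra_simps power_mult_distrib power_numeral_reduce)
  then show ?thesis
    using \<open>e p \<noteq> 0\<close> by (simp add: sectional_def)
qed

lemma stoch_ricci_eq:
  assumes c: "c \<in> A" and e: "Ck_fun A 2 (fst c) e" and p: "p \<in> fst c"
  shows "stoch_ricci A D e c i j p = e p ^ 3 * ricci A D c i j p"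
proof -
  have coord: "Ck_vfield A k (fst c) (coord_field c i)" for k i
    using coord_field_smooth[OF c] by (simp add: smooth_vfield_def)
  show ?thesis
    by (simp add: stoch_ricci_def ricci_def stoch_curv_comp_def curv_comp_def stoch_curvature_def
        comp_in_def curvature_scaled[OF open_domain[OF c] e coord coord coord p] sum_distrib_left)
qed

lemma stoch_scalar_curv_eq:
  assumes c: "c \<in> A" and e: "Ck_fun A 2 (fst c) e" and p: "p \<in> fst c"
  shows "stoch_scalar_curv A g D e c p = e p ^ 3 * scalar_curv A g D c p"
  by (simp add: stoch_scalar_curv_def scalar_curv_def metric_trace_def stoch_ricci_eq[OF assms]
      sum_distrib_left mult.left_commute)

end

theorem theorem3:
  fixes A :: "('m::{t2_space, second_countable_topology}, 'n::finite) chart set"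
    and g :: "'m metric"
    and D :: "'m conn"
    and P :: "'w measure"
    and \<epsilon> :: "'w \<Rightarrow> 'm \<Rightarrow> real"
  assumes "smooth_manifold A"
    and "riemannian_metric A g"
    and "levi_civita A g D"
    and "prob_space P"
    and "\<And>p. (\<lambda>\<omega>. \<epsilon> \<omega> p) \<in> borel_measurable P"
    and "AE \<omega> in P. Ck_fun A 2 UNIV (\<epsilon> \<omega>)"
  shows "AE \<omega> in P.
    (\<forall>W X Y p. open W \<and> smooth_vfield A W X \<and> smooth_vfield A W Y \<and> p \<in> W \<and>
       \<epsilon> \<omega> p \<noteq> 0 \<and> lin_indep2 (X p) (Y p) \<longrightarrow>
       stoch_sectional A g D (\<epsilon> \<omega>) X Y p = sectional A g D X Y p) \<and>
    (\<forall>c\<in>A. \<forall>p\<in>fst c. \<forall>i j.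
       stoch_ricci A D (\<epsilon> \<omega>) c i j p = (\<epsilon> \<omega> p) ^ 3 * ricci A D c i j p) \<and>
    (\<forall>c\<in>A. \<forall>p\<in>fst c.
       stoch_scalar_curv A g D (\<epsilon> \<omega>) c p = (\<epsilon> \<omega> p) ^ 3 * scalar_curv A g D c p)"
proof -
  interpret torsion_free_connection A D
    using assms(1,3) by unfold_locales (auto simp: levi_civita_def)
  show ?thesis
  proof (rule AE_mp[OF assms(6)], rule AE_I2, rule impI)
    fix \<omega> assume "Ck_fun A 2 UNIV (\<epsilon> \<omega>)"
    then have e: "Ck_fun A 2 W (\<epsilon> \<omega>)" for W
      by (rule Ck_fun_subset) simp
    show "(\<forall>W X Y p. open W \<and> smooth_vfield A W X \<and> smooth_vfield A W Y \<and> p \<in> W \<and>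
         \<epsilon> \<omega> p \<noteq> 0 \<and> lin_indep2 (X p) (Y p) \<longrightarrow>
         stoch_sectional A g D (\<epsilon> \<omega>) X Y p = sectional A g D X Y p) \<and>
      (\<forall>c\<in>A. \<forall>p\<in>fst c. \<forall>i j.
         stoch_ricci A D (\<epsilon> \<omega>) c i j p = (\<epsilon> \<omega> p) ^ 3 * ricci A D c i j p) \<and>
      (\<forall>c\<in>A. \<forall>p\<in>fst c.
         stoch_scalar_curv A g D (\<epsilon> \<omega>) c p = (\<epsilon> \<omega> p) ^ 3 * scalar_curv A g D c p)"
    proof (intro conjI allI impI ballI)
      fix W X Y p
      assume "open W \<and> smooth_vfield A W X \<and> smooth_vfield A W Y \<and> p \<in> W \<and>
        \<epsilon> \<omega> p \<noteq> 0 \<and> lin_indep2 (X p) (Y p)"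
      then show "stoch_sectional A g D (\<epsilon> \<omega>) X Y p = sectional A g D X Y p"
        by (intro stoch_sectional_eq[where W = W, OF assms(2) _ e]) (simp_all add: smooth_vfield_def)
    qed (simp_all only: stoch_ricci_eq[OF _ e] stoch_scalar_curv_eq[OF _ e])
  qed
qed

end
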